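(* Let $n\geq 1$ and $N\geq 1$ be integers, and let $\underline{\rho}=(\rho_1,\dots,\rho_N)$ be any ordered collection of fundamental representations of $\mathfrak{gl}_n=\mathfrak{gl}_n(\mathbb{C})$, i.e. each $\rho_i$ is an exterior power $\Lambda^{k_i}(\mathbb{C}^n)$, $1\leq k_i\leq n$, of the standard (defining) representation $\mathbb{C}^n$. Then the $\mathfrak{gl}_n$-weight system $W_{\underline{\rho}}:\mathscr{A}^{\rm h}_N\to\mathbb{C}$ is a quantum state, i.e. $W_{\underline{\rho}}(x\cdot x^\star)$ is a real number $\geq 0$ for every $x\in\mathscr{A}^{\rm h}_N$, and $W_{\underline{\rho}}(1)>0$.
   Context: **$\star$-algebras and states.** A complex $\star$-algebra is a unital associative $\mathbb{C}$-algebra $\mathscr{O}$ with an involution $\star:\mathscr{O}\to\mathscr{O}$ such that $1^\star=1$, $(za+wb)^\star=\overline{z}a^\star+\overline{w}b^\star$ for $z,w\in\mathbb{C}$, and $(ab)^\star=b^\star a^\star$. A quantum state (or state) on $\mathscr{O}$ is a $\mathbb{C}$-linear map $\varphi:\mathscr{O}\to\mathbb{C}$ with $\varphi(x x^\star)\geq 0$ for all $x\in\mathscr{O}$ and $\varphi(1_{\mathscr{O}})>0$. **Horizontal chord diagrams.** Let $\mathscr{D}^{\rm h}_N$ be the free monoid (operation $\circ$) generated by the chords $(i,j)$, $1\leq i<j\leq N$; its neutral element is the chord-less diagram $\uparrow_N$. Write also $(j,i)=(i,j)$. The algebra of horizontal chord diagrams on $N$ strands is $\mathscr{A}^{\rm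 h}_N=\mathbb{C}[\mathscr{D}^{\rm h}_N]/I$, where $I$ is the two-sided ideal generated by the infinitesimal pure braid relations: $(i,j)\circ(k,l)-(k,l)\circ(i,j)$ for pairwise distinct $i,j,k,l$ (2T), and $(i,j)\circ(i,k)+(i,j)\circ(j,k)-(i,k)\circ(i,j)-(j,k)\circ(i,j)$ for pairwise distinct $i,j,k$ (4T). It is a complex $\star$-algebra with unit $\uparrow_N$ and with $\star$ the anti-linear extension of $[(i_1,j_1)\circ\cdots\circ(i_r,j_r)]^\star=(i_r,j_r)\circ\cdots\circ(i_1,j_1)$. **$\mathfrak{gl}_n$-weight systems.** Equip $\mathfrak{gl}_n$ with the bilinear form $\langle A,B\rangle=\mathrm{Tr}(AB)$ and let $e_1,\dots,e_{n^2}$ be an orthonormal basis of $\mathfrak{gl}_n$ for it. Given finite-dimensional representations $\rho_i:\mathfrak{gl}_n\to\mathrm{End}(V_i)$, $i=1,\dots,N$, let $\widetilde{W}_{\underline{\rho}}:\mathscr{A}^{\rm h}_N\to\mathrm{End}(V_1\otimes\cdots\otimes V_N)$ be the unital algebra homomorphism determined by $$\widetilde{W}_{\underline{\rho}}((i,j))=\sum_{r=1}^{n^2}\mathrm{Id}_{V_1}\otimes\cdots\otimes\rho_i(e_r)\otimes\cdots\otimes\rho_j(e_r)\otimes\cdots\otimes\mathrm{Id}_{V_N},$$ with $\rho_i(e_r)$ in the $i$-th position, $\rho_j(e_r)$ in the $j$-th position, and identities elsewhere (it is a standard fact that this is well defined and independent of the orthonormal basis). The weight system is $W_{\underline{\rho}}(x)=\mathrm{Tr}(\widetilde{W}_{\underline{\rho}}(x))$.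 *)

theory Defs
  imports
    "HOL-Algebra.QuotRing"
    "HOL-Algebra.Module"
    "HOL-Library.FuncSet"
    "HOL-Library.Poly_Mapping"
    "HOL-Library.Nonpos_Ints"
    "Jordan_Normal_Form.Determinant"
    "Jordan_Normal_Form.DL_Submatrix"
begin

section \<open>Complex star-algebras and states\<close>

text \<open>The library locale \<open>algebra\<close> demands a commutative multiplication, so the axioms of a
  (noncommutative) unital associative complex algebra are added to \<^locale>\<open>ring\<close> here.\<close>

record 'a star_algebra = "(complex, 'a) module" +
  star :: "'a \<Rightarrow> 'a"

locale complex_star_algebra = ring A for A :: "('a, 'm) star_algebra_scheme" (structure) +
  assumes smult_closed: "x \<in> carrier A \<Longrightarrow> c \<odot> x \<in> carrier A"
    and smult_l_distr: "x \<in> carrier A \<Longrightarrow> (c + d) \<odot> x = c \<odot> x \<oplus> d \<odot> x"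
    and smult_r_distr:
      "x \<in> carrier A \<Longrightarrow> y \<in> carrier A \<Longrightarrow> c \<odot> (x \<oplus> y) = c \<odot> x \<oplus> c \<odot> y"
    and smult_assoc: "x \<in> carrier A \<Longrightarrow> (c * d) \<odot> x = c \<odot> (d \<odot> x)"
    and smult_one: "x \<in> carrier A \<Longrightarrow> 1 \<odot> x = x"
    and smult_mult_left:
      "x \<in> carrier A \<Longrightarrow> y \<in> carrier A \<Longrightarrow> (c \<odot> x) \<otimes> y = c \<odot> (x \<otimes> y)"
    and smult_mult_right:
      "x \<in> carrier A \<Longrightarrow> y \<in> carrier A \<Longrightarrow> x \<otimes> (c \<odot> y) = c \<odot> (x \<otimes> y)"
    and star_closed: "x \<in> carrier A \<Longrightarrow> star A x \<in> carrier A"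
    and star_star: "x \<in> carrier A \<Longrightarrow> star A (star A x) = x"
    and star_one: "star A \<one> = \<one>"
    and star_antilinear:
      "x \<in> carrier A \<Longrightarrow> y \<in> carrier A \<Longrightarrow>
        star A (c \<odot> x \<oplus> d \<odot> y) = cnj c \<odot> star A x \<oplus> cnj d \<odot> star A y"
    and star_mult:
      "x \<in> carrier A \<Longrightarrow> y \<in> carrier A \<Longrightarrow> star A (x \<otimes> y) = star A y \<otimes> star A x"

locale quantum_state = complex_star_algebra A
  for A :: "('a, 'm) star_algebra_scheme" (structure) and \<phi> :: "'a \<Rightarrow> complex" +
  assumes linear:
      "x \<in> carrier A \<Longrightarrow> y \<in> carrier A \<Longrightarrow> \<phi> (c \<odot> x \<oplus> d \<odot> y) = c * \<phi> x + d * \<phi> y"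
    and positive: "x \<in> carrier A \<Longrightarrow> \<phi> (x \<otimes> star A x) \<in> \<real>\<^sub>\<ge>\<^sub>0"
    and one_positive: "\<phi> \<one> \<in> \<real> \<and> Re (\<phi> \<one>) > 0"

section \<open>Horizontal chord diagrams\<close>

text \<open>The type below carries the free monoid on all pairs of naturals, written additively because
  the product of \<^typ>\<open>'a \<Rightarrow>\<^sub>0 'b\<close> is the convolution product for a (not necessarily
  commutative) \<^class>\<open>monoid_add\<close> of exponents. Thus \<open>diagram \<Rightarrow>\<^sub>0 complex\<close> is the
  monoid algebra; \<open>+\<close> on diagrams is the composition of diagrams.\<close>

datatype diagram = Diagram (chords: "(nat \<times> nat) list")

instantiation diagram :: monoid_add
begin
definition zero_diagram :: diagram where "zero_diagram = Diagram []"
definition plus_diagram :: "diagram \<Rightarrow> diagram \<Rightarrow> diagram"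
  where "plus_diagram d e = Diagram (chords d @ chords e)"
instance by standard (simp_all add: zero_diagram_def plus_diagram_def)
end

definition horizontal_diagrams :: "nat \<Rightarrow> diagram set"
  where "horizontal_diagrams N = {d. \<forall>(i, j) \<in> set (chords d). 1 \<le> i \<and> i < j \<and> j \<le> N}"

definition rev_diagram :: "diagram \<Rightarrow> diagram"
  where "rev_diagram d = Diagram (rev (chords d))"

definition diagram_ring :: "nat \<Rightarrow> (diagram \<Rightarrow>\<^sub>0 complex) ring"
  where "diagram_ring N =
    \<lparr>carrier = {x. Poly_Mapping.keys x \<subseteq> horizontal_diagrams N}, monoid.mult = (*), one = 1, zero = 0, add = (+)\<rparr>"

definition diagram_smult :: "complex \<Rightarrow> (diagram \<Rightarrow>\<^sub>0 complex) \<Rightarrow> (diagram \<Rightarrow>\<^sub>0 complex)"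
  where "diagram_smult c x = Poly_Mapping.map ((*) c) x"

definition diagram_star :: "(diagram \<Rightarrow>\<^sub>0 complex) \<Rightarrow> (diagram \<Rightarrow>\<^sub>0 complex)"
  where "diagram_star x =
    (\<Sum>d\<in>Poly_Mapping.keys x. Poly_Mapping.single (rev_diagram d) (cnj (Poly_Mapping.lookup x d)))"

definition chord :: "nat \<Rightarrow> nat \<Rightarrow> (diagram \<Rightarrow>\<^sub>0 complex)"
  where "chord i j = Poly_Mapping.single (Diagram [(min i j, max i j)]) 1"

definition relations_2T :: "nat \<Rightarrow> (diagram \<Rightarrow>\<^sub>0 complex) set"
  where "relations_2T N = {chord i j * chord k l - chord k l * chord i j | i j k l.
    {i, j, k, l} \<subseteq> {1..N} \<and> distinct [i, j, k, l]}"

definition relations_4T :: "nat \<Rightarrow> (diagram \<Rightarrow>\<^sub>0 complex) set"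
  where "relations_4T N =
    {chord i j * chord i k + chord i j * chord j k - chord i k * chord i j - chord j k * chord i j
      | i j k. {i, j, k} \<subseteq> {1..N} \<and> distinct [i, j, k]}"

definition braid_ideal :: "nat \<Rightarrow> (diagram \<Rightarrow>\<^sub>0 complex) set"
  where "braid_ideal N = Idl\<^bsub>diagram_ring N\<^esub> (relations_2T N \<union> relations_4T N)"

text \<open>The ring structure is that of \<open>diagram_ring N Quot braid_ideal N\<close>. As in the library
  definition of \<^const>\<open>FactRing\<close>, the additional operations on cosets are unions over all
  representatives of the coset of the result.\<close>

definition chord_algebra :: "nat \<Rightarrow> (diagram \<Rightarrow>\<^sub>0 complex) set star_algebra"
  where "chord_algebra N =
    (let R = diagram_ring N; I = braid_ideal N; Q = R Quot I in
     \<lparr>carrier = carrier Q, monoid.mult = monoid.mult Q, one = one Q, zero = zero Q, add = add Q,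
      module.smult = (\<lambda>c X. \<Union>x\<in>X. I +>\<^bsub>R\<^esub> diagram_smult c x),
      star = (\<lambda>X. \<Union>x\<in>X. I +>\<^bsub>R\<^esub> diagram_star x)\<rparr>)"

section \<open>Operators on spaces with a finite basis\<close>

text \<open>A finite-dimensional space with basis indexed by the finite set \<open>B\<close> is \<open>\<complex>\<^sup>B\<close>, and an
  endomorphism is given by its matrix, the entry \<open>X a b\<close> being the coefficient of the \<open>a\<close>-th basis
  vector in the image of the \<open>b\<close>-th one. The operators on tensor products below vanish off the basis,
  so that equality of functions is equality of operators.\<close>

type_synonym 'b operator = "'b \<Rightarrow> 'b \<Rightarrow> complex"

definition id_op :: "'b set \<Rightarrow> 'b operator"
  where "id_op B = (\<lambda>a b. if a \<in> B \<and> a = b then 1 else 0)"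

definition comp_op :: "'b set \<Rightarrow> 'b operator \<Rightarrow> 'b operator \<Rightarrow> 'b operator"
  where "comp_op B X Y = (\<lambda>a b. \<Sum>c\<in>B. X a c * Y c b)"

definition trace_op :: "'b set \<Rightarrow> 'b operator \<Rightarrow> complex"
  where "trace_op B X = (\<Sum>b\<in>B. X b b)"

text \<open>The tensor product of the spaces \<open>\<complex>\<^bsup>B l\<^esup>\<close>, \<open>1 \<le> l \<le> N\<close>, has the basis \<open>tensor_basis N B\<close>
  of pure tensors of basis vectors; \<open>tensor_op\<close> is the Kronecker product.\<close>

definition tensor_basis :: "nat \<Rightarrow> (nat \<Rightarrow> 'b set) \<Rightarrow> (nat \<Rightarrow> 'b) set"
  where "tensor_basis N B = (\<Pi>\<^sub>E l\<in>{1..N}. B l)"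

definition tensor_op :: "nat \<Rightarrow> (nat \<Rightarrow> 'b set) \<Rightarrow> (nat \<Rightarrow> 'b operator) \<Rightarrow> (nat \<Rightarrow> 'b) operator"
  where "tensor_op N B X = (\<lambda>a b.
    if a \<in> tensor_basis N B \<and> b \<in> tensor_basis N B then \<Prod>l\<in>{1..N}. X l (a l) (b l) else 0)"

section \<open>Weight systems of the general linear Lie algebra\<close>

text \<open>The Lie algebra is \<^term>\<open>carrier_mat n n :: complex mat set\<close>.\<close>

definition trace_form :: "nat \<Rightarrow> complex mat \<Rightarrow> complex mat \<Rightarrow> complex"
  where "trace_form n A B = (\<Sum>i<n. (A * B) $$ (i, i))"

text \<open>Linear independence is implied by orthonormality.\<close>

definition orthonormal_basis :: "nat \<Rightarrow> (nat \<Rightarrow> complex mat) \<Rightarrow> bool"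
  where "orthonormal_basis n e \<longleftrightarrow>
    (\<forall>r<n\<^sup>2. e r \<in> carrier_mat n n) \<and>
    (\<forall>r<n\<^sup>2. \<forall>s<n\<^sup>2. trace_form n (e r) (e s) = (if r = s then 1 else 0)) \<and>
    (\<forall>A\<in>carrier_mat n n. \<exists>c. A = mat n n (\<lambda>(i, j). \<Sum>r<n\<^sup>2. c r * e r $$ (i, j)))"

record 'b representation =
  basis :: "'b set"
  action :: "complex mat \<Rightarrow> 'b operator"

definition chord_op ::
    "nat \<Rightarrow> nat \<Rightarrow> (nat \<Rightarrow> complex mat) \<Rightarrow> (nat \<Rightarrow> 'b representation) \<Rightarrow> nat \<Rightarrow> nat
      \<Rightarrow> (nat \<Rightarrow> 'b) operator"
  where "chord_op n N e \<rho> i j = (\<lambda>a b. \<Sum>r<n\<^sup>2.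
    tensor_op N (\<lambda>l. basis (\<rho> l))
      (\<lambda>l. if l = i \<or> l = j then action (\<rho> l) (e r) else id_op (basis (\<rho> l))) a b)"

text \<open>The homomorphism to operators, first on the monoid algebra, then on the quotient. As
  the former is constant on each coset, the image of a coset is a singleton.\<close>

definition diagram_op ::
    "nat \<Rightarrow> nat \<Rightarrow> (nat \<Rightarrow> complex mat) \<Rightarrow> (nat \<Rightarrow> 'b representation) \<Rightarrow> diagram
      \<Rightarrow> (nat \<Rightarrow> 'b) operator"
  where "diagram_op n N e \<rho> d =
    (let B = tensor_basis N (\<lambda>l. basis (\<rho> l)) in
     foldr (\<lambda>(i, j). comp_op B (chord_op n N e \<rho> i j)) (chords d) (id_op B))"

definition free_weight_hom ::
    "nat \<Rightarrow> nat \<Rightarrow> (nat \<Rightarrow> complex mat) \<Rightarrow> (nat \<Rightarrow> 'b representation) \<Rightarrow> (diagram \<Rightarrow>\<^sub>0 complex)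
      \<Rightarrow> (nat \<Rightarrow> 'b) operator"
  where "free_weight_hom n N e \<rho> x =
    (\<lambda>a b. \<Sum>d\<in>Poly_Mapping.keys x. Poly_Mapping.lookup x d * diagram_op n N e \<rho> d a b)"

definition weight_hom ::
    "nat \<Rightarrow> nat \<Rightarrow> (nat \<Rightarrow> complex mat) \<Rightarrow> (nat \<Rightarrow> 'b representation)
      \<Rightarrow> (diagram \<Rightarrow>\<^sub>0 complex) set \<Rightarrow> (nat \<Rightarrow> 'b) operator"
  where "weight_hom n N e \<rho> X = the_elem (free_weight_hom n N e \<rho> ` X)"

definition weight_system ::
    "nat \<Rightarrow> nat \<Rightarrow> (nat \<Rightarrow> complex mat) \<Rightarrow> (nat \<Rightarrow> 'b representation)
      \<Rightarrow> (diagram \<Rightarrow>\<^sub>0 complex) set \<Rightarrow> complex"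
  where "weight_system n N e \<rho> X =
    trace_op (tensor_basis N (\<lambda>l. basis (\<rho> l))) (weight_hom n N e \<rho> X)"

section \<open>Exterior powers of the standard representation\<close>

text \<open>The \<open>k\<close>-th exterior power of \<open>\<complex>\<^sup>n\<close> has the basis \<open>e\<^sub>S = e\<^bsub>s_1\<^esub> \<and> \<dots> \<and> e\<^bsub>s_k\<^esub>\<close> indexed by
  the sets \<open>S = {s_1 < \<dots> < s_k}\<close> of indices (counted from \<open>0\<close>, as the library does for matrices).
  The coefficient of \<open>e\<^sub>S\<close> in \<open>v_1 \<and> \<dots> \<and> v_k\<close> is the minor of the matrix with columns
  \<open>v_1, \<dots>, v_k\<close> on the rows in \<open>S\<close>.\<close>

definition ext_basis :: "nat \<Rightarrow> nat \<Rightarrow> nat set set"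
  where "ext_basis n k = {S. S \<subseteq> {0..<n} \<and> card S = k}"

definition wedge :: "nat \<Rightarrow> complex vec list \<Rightarrow> nat set \<Rightarrow> complex"
  where "wedge n vs S = det (submatrix (mat_of_cols n vs) S UNIV)"

text \<open>The action \<open>A \<cdot> (v_1 \<and> \<dots> \<and> v_k) = (\<Sum>p. v_1 \<and> \<dots> \<and> A v_p \<and> \<dots> \<and> v_k)\<close>,
  evaluated on the basis vector \<open>e\<^sub>T\<close>.\<close>

definition ext_action :: "nat \<Rightarrow> complex mat \<Rightarrow> nat set operator"
  where "ext_action n A S T =
    (let vs = map (unit_vec n) (sorted_list_of_set T) in
     \<Sum>p<length vs. wedge n (vs[p := A *\<^sub>v (vs ! p)]) S)"

definition exterior_power :: "nat \<Rightarrow> nat \<Rightarrow> nat set representation"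
  where "exterior_power n k = \<lparr>basis = ext_basis n k, action = ext_action n\<rparr>"

end

theory Submission
  imports Defs "HOL-Library.Function_Algebras"
begin

text \<open>For an orthonormal basis of the trace form, \<open>\<Sum>r. e\<^sub>r \<otimes> e\<^sub>r\<close> equals \<open>\<Sum>a b. E\<^bsub>ab\<^esub> \<otimes> E\<^bsub>ba\<^esub>\<close> in
  terms of the matrix units. On an exterior power \<open>E\<^bsub>ab\<^esub>\<close> acts as \<open>c\<^sub>a\<^sup>* c\<^sub>b\<close> for fermionic
  annihilation operators \<open>c\<^sub>b\<close>, so the canonical anticommutation relations give the commutators of
  \<open>gl\<^sub>n\<close>, and \<open>E\<^bsub>ab\<^esub>\<close> and \<open>E\<^bsub>ba\<^esub>\<close> are adjoint to each other in the standard basis. Hence every chord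
  acts by a Hermitian operator and the star of the chord algebra goes to the adjoint: if \<open>x\<close> acts
  as \<open>M\<close>, then \<open>x x\<^sup>*\<close> has weight \<open>Tr (M M\<^sup>*)\<close>, the sum of the squared absolute values of
  the entries of \<open>M\<close>.\<close>

section \<open>The algebra of operators\<close>

lemma sum_operator_apply: "(\<Sum>i\<in>I. X i) a b = (\<Sum>i\<in>I. X i a b :: complex)"
  by (induction I rule: infinite_finite_induct) auto

lemma comp_op_assoc: "comp_op B (comp_op B X Y) Z = comp_op B X (comp_op B Y Z)"
proof (intro ext)
  fix a b
  show "comp_op B (comp_op B X Y) Z a b = comp_op B X (comp_op B Y Z) a b"
    unfolding comp_op_def
    by (simp add: sum_distrib_left sum_distrib_right mult.assoc) (rule sum.swap)
qed

text \<open>Linear combinations of operators use the pointwise group structure of functions. With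
  \<open>plus_fun_apply\<close> and \<open>zero_fun_apply\<close> removed from the simpset, later
  arguments stay at this level instead of passing to entries.\<close>

lemma comp_op_bilinear:
  "comp_op B (X + Y) Z = comp_op B X Z + comp_op B Y Z"
  "comp_op B X (Y + Z) = comp_op B X Y + comp_op B X Z"
  "comp_op B (X - Y) Z = comp_op B X Z - comp_op B Y Z"
  "comp_op B X (Y - Z) = comp_op B X Y - comp_op B X Z"
  "comp_op B (- X) Z = - comp_op B X Z"
  "comp_op B X (- Z) = - comp_op B X Z"
  "comp_op B 0 Z = 0"
  "comp_op B X 0 = 0"
  by (auto simp: comp_op_def fun_eq_iff algebra_simps sum.distrib sum_subtractf sum_negf)

lemma comp_op_sum_left: "comp_op B (\<Sum>i\<in>I. X i) Z = (\<Sum>i\<in>I. comp_op B (X i) Z)"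
  by (induction I rule: infinite_finite_induct) (simp_all add: comp_op_bilinear del: plus_fun_apply zero_fun_apply)

lemma comp_op_sum_right: "comp_op B X (\<Sum>i\<in>I. Z i) = (\<Sum>i\<in>I. comp_op B X (Z i))"
  by (induction I rule: infinite_finite_induct) (simp_all add: comp_op_bilinear del: plus_fun_apply zero_fun_apply)

text \<open>\<open>id_op B\<close> has zero rows and columns off \<open>B\<close>, where a general
  operator may have nonzero entries; hence the unit laws are entrywise.\<close>

lemma comp_op_id_left: "finite B \<Longrightarrow> a \<in> B \<Longrightarrow> comp_op B (id_op B) X a b = X a b"
  by (simp add: comp_op_def id_op_def if_distrib[of "\<lambda>x. x * _"] cong: if_cong)

lemma comp_op_id_right: "finite B \<Longrightarrow> b \<in> B \<Longrightarrow> comp_op B X (id_op B) a b = X a b"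
  by (simp add: comp_op_def id_op_def if_distrib[of "\<lambda>x. _ * x"] cong: if_cong)

definition adjoint_op :: "'b operator \<Rightarrow> 'b operator"
  where "adjoint_op X = (\<lambda>a b. cnj (X b a))"

lemma adjoint_op_comp: "adjoint_op (comp_op B X Y) = comp_op B (adjoint_op Y) (adjoint_op X)"
  by (simp add: adjoint_op_def comp_op_def mult.commute)

lemma adjoint_op_sum: "adjoint_op (\<Sum>i\<in>I. X i) = (\<Sum>i\<in>I. adjoint_op (X i))"
  by (intro ext) (simp add: adjoint_op_def sum_operator_apply)

lemma adjoint_op_id: "adjoint_op (id_op B) = id_op B"
  by (auto simp: adjoint_op_def id_op_def fun_eq_iff)

definition bracket_op :: "'b set \<Rightarrow> 'b operator \<Rightarrow> 'b operator \<Rightarrow> 'b operator"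
  where "bracket_op B X Y = comp_op B X Y - comp_op B Y X"

lemma bracket_op_linear:
  "bracket_op B X (Y + Z) = bracket_op B X Y + bracket_op B X Z"
  "bracket_op B (\<Sum>i\<in>I. X' i) Z = (\<Sum>i\<in>I. bracket_op B (X' i) Z)"
  "bracket_op B X (\<Sum>i\<in>I. X' i) = (\<Sum>i\<in>I. bracket_op B X (X' i))"
  by (simp_all add: bracket_op_def comp_op_bilinear comp_op_sum_left comp_op_sum_right sum_subtractf
      del: plus_fun_apply)

text \<open>Bracketing with a fixed operator is a derivation. This Leibniz rule reduces brackets of
  Casimir operators to brackets of operators at single sites.\<close>

lemma bracket_op_comp:
  "bracket_op B (comp_op B X Y) Z = comp_op B X (bracket_op B Y Z) + comp_op B (bracket_op B X Z) Y"
  "bracket_op B Z (comp_op B X Y) = comp_op B X (bracket_op B Z Y) + comp_op B (bracket_op B Z X) Y"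
  by (simp_all add: bracket_op_def comp_op_bilinear comp_op_assoc)

section \<open>Exterior powers\<close>

text \<open>An element is determined by its rank, the number of smaller elements. Deleting the
  \<open>i\<close>-th element lowers by one exactly the ranks above \<open>i\<close>, which is the
  shift undone by \<open>insert_index\<close>.\<close>

lemma pick_delete:
  assumes "i < card S" "j < card S - 1"
  shows "pick (S - {pick S i}) j = pick S (insert_index i j)"
proof -
  let ?s = "pick S (insert_index i j)" and ?S = "S - {pick S i}"
  have fin: "finite S" using assms(1) card.infinite by fastforce
  have l: "insert_index i j < card S" using assms by (auto simp: insert_index_def)
  have iff: "pick S p < pick S q \<longleftrightarrow> p < q" if "p < card S" "q < card S" for p q
    using pick_mono_le[of q S p] pick_mono_le[of p S q] that by (metis nat_neq_iff order_less_asym)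
  have "?s \<noteq> pick S i" using iff[OF l assms(1)] iff[OF assms(1) l]
    by (auto simp: insert_index_def split: if_splits)
  then have mem: "?s \<in> ?S" using pick_in_set_le[OF l] by blast
  have "{a \<in> ?S. a < ?s} = {a \<in> S. a < ?s} - {pick S i}" by blast
  \<comment> \<open>The deleted element was counted below \<open>?s\<close> exactly when
    \<open>i \<le> j\<close>, the case in which \<open>insert_index i j\<close> is
    \<open>Suc j\<close>.\<close>
  moreover have "pick S i \<in> {a \<in> S. a < ?s} \<longleftrightarrow> i < insert_index i j"
    using iff[OF assms(1) l] pick_in_set_le[OF assms(1)] by simp
  ultimately have "card {a \<in> ?S. a < ?s} = j"
    using card_pick_le[OF l] fin by (auto simp: insert_index_def card_Diff_singleton_if split: if_splits)
  then show ?thesis using pick_card_in_set[OF mem] by metis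
qed

lemma bij_betw_pick:
  assumes "finite S"
  shows "bij_betw (pick S) {..<card S} S"
\<comment> \<open>The inverse of the enumeration is the rank.\<close>
proof (rule bij_betwI[where g = "\<lambda>s. card {a \<in> S. a < s}"])
  show "(\<lambda>s. card {a \<in> S. a < s}) \<in> S \<rightarrow> {..<card S}"
    using assms by (auto intro!: psubset_card_mono)
qed (auto intro: pick_in_set_le card_pick_le pick_card_in_set)

lemma nth_sorted_list_of_set:
  assumes "finite S" "i < card S"
  shows "sorted_list_of_set S ! i = pick S i"
proof -
  have "sorted_wrt (<) (map (pick S) [0..<card S])"
    by (auto simp: sorted_wrt_iff_nth_less intro: pick_mono_le)
  moreover have "set (map (pick S) [0..<card S]) = S"
    using bij_betw_imp_surj_on[OF bij_betw_pick[OF assms(1)]] by (simp add: atLeast0LessThan)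
  ultimately have "sorted_list_of_set S = map (pick S) [0..<card S]"
    using sorted_list_of_set.idem_if_sorted_distinct strict_sorted_iff by metis
  then show ?thesis using assms(2) by simp
qed

text \<open>For equal sets the matrix is the identity. Otherwise, the cardinalities being equal,
  some element of \<open>S\<close> is missing from \<open>T\<close>, and its row is zero. These
  determinants occur as minors of wedge products.\<close>

lemma det_kronecker:
  assumes "finite S" "finite T" "card S = m" "card T = m"
  shows "det (mat m m (\<lambda>(i, j). if pick S i = pick T j then 1 else 0)) = (if S = T then 1 else 0 :: complex)"
    (is "det ?M = _")
proof (cases "S = T")
  case True
  have "pick T i = pick T j \<longleftrightarrow> i = j" if "i < m" "j < m" for i j
    using bij_betw_imp_inj_on[OF bij_betw_pick[OF assms(2)]] that assms(4) by (auto dest: inj_onD)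
  then have "?M = 1\<^sub>m m" by (intro eq_matI) (auto simp: True)
  then show ?thesis using True by simp
next
  case False
  then obtain s where s: "s \<in> S" "s \<notin> T" using card_seteq[OF assms(2), of S] assms by auto
  then obtain i where i: "i < m" "pick S i = s"
    using bij_betw_imp_surj_on[OF bij_betw_pick[OF assms(1)]] assms(3) by (metis imageE lessThan_iff)
  have "?M $$ (i, j) = 0" if "j < m" for j
    using i s that pick_in_set_le[of j T] assms(4) by auto
  then have "det ?M = 0"
    by (subst laplace_expansion_row[of _ m i]) (use i in auto)
  then show ?thesis using False by simp
qed

text \<open>The exterior algebra is a fermionic Fock space: \<open>annihilate n a\<close> is contraction with the
  \<open>a\<close>-th coordinate, its transpose is the wedge product with the \<open>a\<close>-th unit vector.\<close>

definition fermion_sign :: "nat set \<Rightarrow> nat \<Rightarrow> complex"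
  where "fermion_sign T a = (- 1) ^ card {t \<in> T. t < a}"

definition annihilate :: "nat \<Rightarrow> nat \<Rightarrow> nat set operator"
  where "annihilate n a U T =
    (if T \<subseteq> {..<n} \<and> a \<in> T \<and> U = T - {a} then fermion_sign T a else 0)"

definition create :: "nat \<Rightarrow> nat \<Rightarrow> nat set operator"
  where "create n a U T = annihilate n a T U"

text \<open>The image of the matrix unit \<open>E_ab\<close>. The sum runs over all of
  \<open>Pow {..<n}\<close>, not over one exterior power, because the two factors change the
  degree.\<close>

definition ext_unit :: "nat \<Rightarrow> nat \<Rightarrow> nat \<Rightarrow> nat set operator"
  where "ext_unit n a b = comp_op (Pow {..<n}) (create n a) (annihilate n b)"

text \<open>Only the intermediate set \<open>T - {b}\<close> contributes, and the creation factor
  forces it to equal \<open>S - {a}\<close>.\<close>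

lemma ext_unit_apply:
  "ext_unit n a b S T =
    (if S \<subseteq> {..<n} \<and> T \<subseteq> {..<n} \<and> a \<in> S \<and> b \<in> T \<and> S - {a} = T - {b}
     then fermion_sign S a * fermion_sign T b else 0)"
proof (cases "T \<subseteq> {..<n} \<and> b \<in> T")
  case True
  have "ext_unit n a b S T = (\<Sum>U\<in>{T - {b}}. annihilate n a U S * annihilate n b U T)"
    unfolding ext_unit_def comp_op_def create_def
    by (rule sum.mono_neutral_right) (use True in \<open>auto simp: annihilate_def\<close>)
  then show ?thesis using True by (auto simp: annihilate_def)
next
  case False
  then have "annihilate n b U T = 0" for U by (auto simp: annihilate_def)
  then have "ext_unit n a b S T = 0" by (simp add: ext_unit_def comp_op_def)
  then show ?thesis using False by auto
qed

lemma ext_basis_iff: "S \<in> ext_basis n k \<longleftrightarrow> S \<subseteq> {..<n} \<and> card S = k"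
  by (auto simp: ext_basis_def atLeast0LessThan)

text \<open>Laplace expansion along column \<open>p\<close>, the only column that is not a unit
  vector. The remaining minors are Kronecker determinants of the sets with one element
  removed.\<close>

lemma wedge_update:
  assumes "S \<in> ext_basis n k" "T \<in> ext_basis n k" "A \<in> carrier_mat n n" "p < k"
  shows "wedge n ((map (unit_vec n) (sorted_list_of_set T))[p := A *\<^sub>v unit_vec n (pick T p)]) S =
    (\<Sum>i<k. A $$ (pick S i, pick T p) * (- 1) ^ (i + p) *
      (if S - {pick S i} = T - {pick T p} then 1 else 0))"
    (is "wedge n ?vs S = _")
proof -
  have S: "S \<subseteq> {..<n}" "card S = k" "finite S" and T: "T \<subseteq> {..<n}" "card T = k" "finite T"
    using assms(1,2) by (auto simp: ext_basis_iff finite_subset)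
  let ?M = "mat k k (\<lambda>(i, q). if q = p then A $$ (pick S i, pick T p)
    else if pick S i = pick T q then 1 else 0)"
  have pS: "pick S i < n" if "i < k" for i using pick_in_set_le[of i S] that S by auto
  have pT: "pick T i < n" if "i < k" for i using pick_in_set_le[of i T] that T by auto
  \<comment> \<open>\<open>submatrix\<close> takes its number of rows from this set, so that number
    is \<open>k\<close>.\<close>
  have "{i. i < n \<and> i \<in> S} = S" using S by auto
  then have sub: "submatrix (mat_of_cols n ?vs) S UNIV = ?M"
    unfolding submatrix_def
    using S T assms(3,4) pS pT
    by (intro eq_matI)
      (auto simp: mat_of_cols_index pick_UNIV nth_sorted_list_of_set nth_list_update)
  have minor: "mat_delete ?M i p = mat (k - 1) (k - 1)
      (\<lambda>(r, q). if pick (S - {pick S i}) r = pick (T - {pick T p}) q then 1 else 0)"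
    if "i < k" for i
    using that assms(4) S T pick_delete[of i S] pick_delete[of p T]
    by (intro eq_matI) (auto simp: mat_delete_def insert_index_def)
  have "det (mat_delete ?M i p) = (if S - {pick S i} = T - {pick T p} then 1 else 0)"
    if "i < k" for i
    unfolding minor[OF that]
    using that assms(4) S T pick_in_set_le[of i S] pick_in_set_le[of p T]
    by (intro det_kronecker) auto
  then have "det ?M = (\<Sum>i<k. A $$ (pick S i, pick T p) * (- 1) ^ (i + p) *
      (if S - {pick S i} = T - {pick T p} then 1 else 0))"
    using assms(4)
    by (subst laplace_expansion_column[of _ k p]) (auto simp: cofactor_def intro!: sum.cong)
  then show ?thesis by (simp add: wedge_def sub)
qed

text \<open>Identifies the derivation action with the Fock space operators: the cofactor signs of
  the Laplace expansion are products of two fermion signs.\<close>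

lemma ext_action_eq_sum_units:
  assumes "S \<in> ext_basis n k" "T \<in> ext_basis n k" "A \<in> carrier_mat n n"
  shows "ext_action n A S T = (\<Sum>a<n. \<Sum>b<n. A $$ (a, b) * ext_unit n a b S T)"
proof -
  have S: "S \<subseteq> {..<n}" "card S = k" "finite S" and T: "T \<subseteq> {..<n}" "card T = k" "finite T"
    using assms(1,2) by (auto simp: ext_basis_iff finite_subset)
  let ?f = "\<lambda>a b. A $$ (a, b) * ext_unit n a b S T"
  \<comment> \<open>Exactly \<open>i\<close> elements of \<open>S\<close> lie below
    \<open>pick S i\<close> and \<open>p\<close> elements of \<open>T\<close> below
    \<open>pick T p\<close>, so the two fermion signs multiply to
    \<open>(- 1) ^ (i + p)\<close>.\<close>
  have unit: "?f (pick S i) (pick T p) = A $$ (pick S i, pick T p) * (- 1) ^ (i + p) *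
      (if S - {pick S i} = T - {pick T p} then 1 else 0)" if "i < k" "p < k" for i p
    using that S T pick_in_set_le[of i S] pick_in_set_le[of p T] card_pick_le[of i S]
      card_pick_le[of p T] by (auto simp: ext_unit_apply fermion_sign_def power_add)
  have "ext_action n A S T = (\<Sum>p<k. \<Sum>i<k. ?f (pick S i) (pick T p))"
    unfolding ext_action_def Let_def
    using wedge_update[OF assms] T by (auto simp: nth_sorted_list_of_set unit simp del: mult_cancel_left intro!: sum.cong)
  also have "\<dots> = (\<Sum>b\<in>T. \<Sum>a\<in>S. ?f a b)"
    using sum.reindex_bij_betw[OF bij_betw_pick[OF T(3)], of "\<lambda>b. \<Sum>a\<in>S. ?f a b"]
      sum.reindex_bij_betw[OF bij_betw_pick[OF S(3)], of "\<lambda>a. ?f a b" for b] S T by simp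
  \<comment> \<open>The sums extend to all indices because \<open>ext_unit n a b S T\<close>
    vanishes unless \<open>a \<in> S\<close> and \<open>b \<in> T\<close>.\<close>
  also have "\<dots> = (\<Sum>b\<in>T. \<Sum>a<n. ?f a b)"
    using S by (intro sum.cong refl sum.mono_neutral_left) (auto simp: ext_unit_apply)
  also have "\<dots> = (\<Sum>b<n. \<Sum>a<n. ?f a b)"
    using T by (intro sum.mono_neutral_left) (auto simp: ext_unit_apply intro!: sum.neutral)
  finally show ?thesis by (subst sum.swap)
qed

section \<open>Canonical anticommutation relations\<close>

lemma fermion_sign_insert:
  assumes "finite T" "b \<notin> T"
  shows "fermion_sign (insert b T) a = (if b < a then - fermion_sign T a else fermion_sign T a)"
proof -
  have "{t \<in> insert b T. t < a} = (if b < a then insert b else id) {t \<in> T. t < a}" by auto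
  then show ?thesis using assms by (simp add: fermion_sign_def)
qed

lemma fermion_sign_square [simp]: "fermion_sign T a * fermion_sign T a = 1"
  by (simp add: fermion_sign_def power_add[symmetric] mult_2[symmetric])

text \<open>Both orders of removal end in the same set. The sign of the larger index depends on
  whether the smaller one is still present, and this differs between the two orders. For
  \<open>a = b\<close> both products vanish.\<close>

lemma annihilate_annihilate:
  "comp_op (Pow {..<n}) (annihilate n a) (annihilate n b) +
    comp_op (Pow {..<n}) (annihilate n b) (annihilate n a) = 0"
proof (intro ext)
  fix U T
  have prod: "comp_op (Pow {..<n}) (annihilate n a) (annihilate n b) U T =
    (if T \<subseteq> {..<n} \<and> a \<in> T \<and> b \<in> T \<and> a \<noteq> b \<and> U = T - {a, b}
     then fermion_sign (T - {b}) a * fermion_sign T b else 0)" for a b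
  proof (cases "T \<subseteq> {..<n} \<and> b \<in> T")
    case True
    have "comp_op (Pow {..<n}) (annihilate n a) (annihilate n b) U T =
      (\<Sum>V\<in>{T - {b}}. annihilate n a U V * annihilate n b V T)"
      unfolding comp_op_def
      by (rule sum.mono_neutral_right) (use True in \<open>auto simp: annihilate_def\<close>)
    moreover have "T - {b} - {a} = T - {a, b}" by auto
    ultimately show ?thesis using True by (auto simp: annihilate_def)
  next
    case False
    then have "annihilate n b V T = 0" for V by (auto simp: annihilate_def)
    then show ?thesis using False by (auto simp: comp_op_def)
  qed
  show "(comp_op (Pow {..<n}) (annihilate n a) (annihilate n b) +
    comp_op (Pow {..<n}) (annihilate n b) (annihilate n a)) U T = 0 U T"
  proof (cases "T \<subseteq> {..<n} \<and> a \<in> T \<and> b \<in> T \<and> a \<noteq> b \<and> U = T - {a, b}")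
    case True
    then have fin: "finite (T - {a, b})" by (auto intro: finite_subset)
    \<comment> \<open>With all sets written as insertions into \<open>R\<close>,
      \<open>fermion_sign_insert\<close> compares the signs: exactly one of \<open>a < b\<close> and
      \<open>b < a\<close> holds.\<close>
    define R where "R = T - {a, b}"
    have T: "T = insert a (insert b R)" "T - {b} = insert a R" "T - {a} = insert b R"
      and R: "finite R" "a \<notin> R" "b \<notin> R" "a \<noteq> b"
      using True fin by (auto simp: R_def)
    have "fermion_sign (T - {b}) a * fermion_sign T b =
      - (fermion_sign (T - {a}) b * fermion_sign T a)"
      unfolding T(2,3) unfolding T(1) using R by (simp add: fermion_sign_insert)
    then show ?thesis unfolding plus_fun_apply prod using True by (simp add: insert_commute)
  qed (auto simp: prod insert_commute)
qed

text \<open>The transpose of the relation for annihilators, since transposing reverses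
  products.\<close>

lemma create_create:
  "comp_op (Pow {..<n}) (create n a) (create n b) +
    comp_op (Pow {..<n}) (create n b) (create n a) = 0"
proof (intro ext)
  fix U T
  have "comp_op (Pow {..<n}) (create n a) (create n b) U T =
    comp_op (Pow {..<n}) (annihilate n b) (annihilate n a) T U" for a b
    by (simp add: comp_op_def create_def mult.commute)
  then show "(comp_op (Pow {..<n}) (create n a) (create n b) +
    comp_op (Pow {..<n}) (create n b) (create n a)) U T = 0 U T"
    using fun_cong[OF fun_cong[OF annihilate_annihilate[of n b a]], of T U] by simp
qed

text \<open>For \<open>a = b\<close> exactly one product is nonzero on each basis vector, according
  to whether \<open>b \<in> T\<close>, and its sign is a square. For \<open>a \<noteq> b\<close>
  both products reach the same set with opposite signs. The bound on \<open>b\<close> keeps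
  \<open>insert b T\<close> inside the Fock basis.\<close>

lemma annihilate_create:
  assumes "a < n" "b < n"
  shows "comp_op (Pow {..<n}) (annihilate n a) (create n b) +
    comp_op (Pow {..<n}) (create n b) (annihilate n a) = (if a = b then id_op (Pow {..<n}) else 0)"
proof (intro ext)
  fix U T
  have prod: "comp_op (Pow {..<n}) (annihilate n a) (create n b) U T =
    (if T \<subseteq> {..<n} \<and> b \<notin> T \<and> a \<in> insert b T \<and> U = insert b T - {a}
     then fermion_sign (insert b T) a * fermion_sign (insert b T) b else 0)"
  proof (cases "T \<subseteq> {..<n} \<and> b \<notin> T")
    case True
    have "comp_op (Pow {..<n}) (annihilate n a) (create n b) U T =
      (\<Sum>V\<in>{insert b T}. annihilate n a U V * annihilate n b T V)"
      unfolding comp_op_def create_def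
      by (rule sum.mono_neutral_right) (use True assms in \<open>auto simp: annihilate_def\<close>)
    then show ?thesis using True assms by (auto simp: annihilate_def)
  next
    case False
    then have "annihilate n b T V = 0" for V by (auto simp: annihilate_def)
    then show ?thesis using False by (auto simp: comp_op_def create_def)
  qed
  have prod': "comp_op (Pow {..<n}) (create n b) (annihilate n a) U T =
    (if U \<subseteq> {..<n} \<and> T \<subseteq> {..<n} \<and> b \<in> U \<and> a \<in> T \<and> U - {b} = T - {a}
     then fermion_sign U b * fermion_sign T a else 0)"
    unfolding ext_unit_def[symmetric] by (rule ext_unit_apply)
  consider (eq) "a = b" | (ne) "a \<noteq> b" "T \<subseteq> {..<n}" "b \<notin> T" "a \<in> T" "U = insert b (T - {a})"
    | (zero) "a \<noteq> b" "\<not> (T \<subseteq> {..<n} \<and> b \<notin> T \<and> a \<in> T \<and> U = insert b (T - {a}))" by blast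
  then show "(comp_op (Pow {..<n}) (annihilate n a) (create n b) +
      comp_op (Pow {..<n}) (create n b) (annihilate n a)) U T =
    (if a = b then id_op (Pow {..<n}) else 0) U T"
  proof cases
    case eq
    have iff: "(U \<subseteq> {..<n} \<and> T \<subseteq> {..<n} \<and> b \<in> U \<and> b \<in> T \<and> U - {b} = T - {b}) \<longleftrightarrow>
        T \<subseteq> {..<n} \<and> b \<in> T \<and> U = T"
      "(T \<subseteq> {..<n} \<and> b \<notin> T \<and> b \<in> insert b T \<and> U = insert b T - {b}) \<longleftrightarrow>
        T \<subseteq> {..<n} \<and> b \<notin> T \<and> U = T"
      by blast+
    show ?thesis unfolding eq plus_fun_apply prod[unfolded eq] prod'[unfolded eq] iff by (auto simp: id_op_def)
  next
    case ne
    define R where "R = T - {a}"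
    have T: "T = insert a R" "U = insert b R" and R: "finite R" "a \<notin> R" "b \<notin> R"
      using ne finite_subset[of T] by (auto simp: R_def)
    have "T \<subseteq> {..<n} \<and> b \<notin> T \<and> a \<in> insert b T \<and> U = insert b T - {a}"
      and "U \<subseteq> {..<n} \<and> T \<subseteq> {..<n} \<and> b \<in> U \<and> a \<in> T \<and> U - {b} = T - {a}"
      using ne assms by auto
    from this[THEN if_P] have "(comp_op (Pow {..<n}) (annihilate n a) (create n b) +
        comp_op (Pow {..<n}) (create n b) (annihilate n a)) U T =
      fermion_sign (insert b T) a * fermion_sign (insert b T) b + fermion_sign U b * fermion_sign T a"
      unfolding plus_fun_apply prod prod' by (rule arg_cong2)
    also have "\<dots> = 0" using ne(1) R by (simp add: T fermion_sign_insert)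
    finally show ?thesis using ne(1) by simp
  next
    case zero
    then have "\<not> (T \<subseteq> {..<n} \<and> b \<notin> T \<and> a \<in> insert b T \<and> U = insert b T - {a})"
      "\<not> (U \<subseteq> {..<n} \<and> T \<subseteq> {..<n} \<and> b \<in> U \<and> a \<in> T \<and> U - {b} = T - {a})"
      by blast+
    then show ?thesis using zero(1) by (simp only: plus_fun_apply prod prod' if_False) simp
  qed
qed

text \<open>Annihilators have zero rows outside the Fock basis, so the left unit law is an equation
  of operators here.\<close>

lemma comp_op_id_annihilate:
  "comp_op (Pow {..<n}) (id_op (Pow {..<n})) (annihilate n a) = annihilate n a"
proof (intro ext)
  fix U T
  show "comp_op (Pow {..<n}) (id_op (Pow {..<n})) (annihilate n a) U T = annihilate n a U T"
  proof (cases "U \<in> Pow {..<n}")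
    case False
    then have "annihilate n a U T = 0" by (auto simp: annihilate_def)
    then show ?thesis using False by (simp add: comp_op_def id_op_def)
  qed (simp add: comp_op_id_left)
qed

text \<open>Normal ordering writes each product as a quadratic term minus a quartic one. The quartic
  term is unchanged when \<open>(a, b)\<close> and \<open>(c, d)\<close> are exchanged, so only
  quadratic terms survive in the commutator.\<close>

lemma ext_unit_commutator:
  assumes "a < n" "b < n" "c < n" "d < n"
  shows "comp_op (Pow {..<n}) (ext_unit n a b) (ext_unit n c d) -
      comp_op (Pow {..<n}) (ext_unit n c d) (ext_unit n a b) =
    (if b = c then ext_unit n a d else 0) - (if a = d then ext_unit n c b else 0)"
proof -
  let ?c = "comp_op (Pow {..<n})" and ?A = "annihilate n" and ?C = "create n"
  have *: "?c (ext_unit n a b) (ext_unit n c d) =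
    (if b = c then ext_unit n a d else 0) - ?c (?C a) (?c (?C c) (?c (?A b) (?A d)))"
    if "b < n" "c < n" for a b c d
  proof -
    have "?c (?A b) (?C c) = (if b = c then id_op (Pow {..<n}) else 0) - ?c (?C c) (?A b)"
      using annihilate_create[OF that] by (simp add: eq_diff_eq)
    then have "?c (?C a) (?c (?c (?A b) (?C c)) (?A d)) = (if b = c then ?c (?C a) (?A d) else 0) -
        ?c (?C a) (?c (?c (?C c) (?A b)) (?A d))"
      by (simp add: comp_op_bilinear comp_op_id_annihilate)
    then show ?thesis by (simp add: ext_unit_def comp_op_assoc)
  qed
  \<comment> \<open>Exchanging the two creators and the two annihilators gives two signs, which
    cancel.\<close>
  have "?c (?C c) (?c (?C a) (?c (?A d) (?A b))) = ?c (?c (?C c) (?C a)) (?c (?A d) (?A b))"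
    by (simp add: comp_op_assoc)
  also have "\<dots> = ?c (- ?c (?C a) (?C c)) (- ?c (?A b) (?A d))"
    using create_create[of n c a] annihilate_annihilate[of n d b] by (simp add: add_eq_0_iff2)
  also have "\<dots> = ?c (?C a) (?c (?C c) (?c (?A b) (?A d)))"
    by (simp add: comp_op_assoc comp_op_bilinear)
  finally show ?thesis using assms by (simp add: *)
qed

text \<open>\<open>ext_unit n c d\<close> preserves cardinality, so only sets of size
  \<open>k\<close> contribute to the larger sum. Thus the commutators on Fock space restrict to
  every exterior power.\<close>

lemma comp_op_ext_unit_ext_basis:
  assumes "T \<in> ext_basis n k"
  shows "comp_op (ext_basis n k) X (ext_unit n c d) S T = comp_op (Pow {..<n}) X (ext_unit n c d) S T"
  unfolding comp_op_def
proof (rule sum.mono_neutral_left)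
  show "\<forall>V\<in>Pow {..<n} - ext_basis n k. X S V * ext_unit n c d V T = 0"
  proof
    fix V assume V: "V \<in> Pow {..<n} - ext_basis n k"
    have "card V = card T" if "c \<in> V" "d \<in> T" "V - {c} = T - {d}"
    proof -
      have "finite V" "finite T" using V assms finite_subset by (auto simp: ext_basis_iff)
      then show ?thesis using that by (metis card_Suc_Diff1)
    qed
    then show "X S V * ext_unit n c d V T = 0"
      using V assms by (auto simp: ext_unit_apply ext_basis_iff)
  qed
qed (auto simp: ext_basis_iff)

lemma finite_ext_basis: "finite (ext_basis n k)"
  by (rule finite_subset[of _ "Pow {..<n}"]) (auto simp: ext_basis_iff)

text \<open>The fermion signs are real, and the condition for a nonzero entry is symmetric under
  exchanging \<open>(a, S)\<close> with \<open>(b, T)\<close>.\<close>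

lemma ext_unit_adjoint: "ext_unit n a b S T = cnj (ext_unit n b a T S)"
  by (auto simp: ext_unit_apply fermion_sign_def)

section \<open>Tensor products of representations\<close>

text \<open>Lets identities known only for entries on the site bases become equations of operators
  on the tensor product.\<close>

lemma tensor_op_cong:
  assumes "\<And>l s t. l \<in> {1..N} \<Longrightarrow> s \<in> B l \<Longrightarrow> t \<in> B l \<Longrightarrow> X l s t = Y l s t"
  shows "tensor_op N B X = tensor_op N B Y"
proof (intro ext)
  fix a b
  have "(\<Prod>l\<in>{1..N}. X l (a l) (b l)) = (\<Prod>l\<in>{1..N}. Y l (a l) (b l))"
    if "a \<in> tensor_basis N B" "b \<in> tensor_basis N B"
    using that PiE_mem[of _ "{1..N}" B] by (intro prod.cong refl assms) (auto simp: tensor_basis_def)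
  then show "tensor_op N B X a b = tensor_op N B Y a b" by (simp add: tensor_op_def)
qed

text \<open>The mixed-product property of Kronecker products: a product over sites of sums expands
  into one sum over the tensor basis.\<close>

lemma comp_tensor_op:
  assumes "\<forall>l\<in>{1..N}. finite (B l)"
  shows "comp_op (tensor_basis N B) (tensor_op N B X) (tensor_op N B Y) =
    tensor_op N B (\<lambda>l. comp_op (B l) (X l) (Y l))"
proof (intro ext)
  fix a b
  show "comp_op (tensor_basis N B) (tensor_op N B X) (tensor_op N B Y) a b =
    tensor_op N B (\<lambda>l. comp_op (B l) (X l) (Y l)) a b"
  proof (cases "a \<in> tensor_basis N B \<and> b \<in> tensor_basis N B")
    case True
    then show ?thesis
      using prod_sum_PiE[of "{1..N}" B "\<lambda>l s. X l (a l) s * Y l s (b l)"] assms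
      by (simp add: comp_op_def tensor_op_def prod.distrib)
        (simp add: tensor_basis_def)
  qed (auto simp: comp_op_def tensor_op_def)
qed

section \<open>Operators acting at a single site\<close>

definition site_op :: "nat \<Rightarrow> (nat \<Rightarrow> 'b set) \<Rightarrow> nat \<Rightarrow> 'b operator \<Rightarrow> (nat \<Rightarrow> 'b) operator"
  where "site_op N B i Y = tensor_op N B (\<lambda>l. if l = i then Y else id_op (B l))"

lemma site_op_apply:
  assumes "i \<in> {1..N}"
  shows "site_op N B i Y s t = (if s \<in> tensor_basis N B \<and> t \<in> tensor_basis N B
    then Y (s i) (t i) * (\<Prod>l\<in>{1..N} - {i}. id_op (B l) (s l) (t l)) else 0)"
  using assms by (simp add: site_op_def tensor_op_def prod.remove[of "{1..N}" i] del: One_nat_def)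

lemma site_op_linear:
  assumes "i \<in> {1..N}"
  shows "site_op N B i (Y - Z) = site_op N B i Y - site_op N B i Z" "site_op N B i 0 = 0"
  using assms by (auto simp: site_op_apply fun_eq_iff algebra_simps)

lemma adjoint_site_op: "adjoint_op (site_op N B i Y) = site_op N B i (adjoint_op Y)"
  by (auto simp: fun_eq_iff adjoint_op_def site_op_def tensor_op_def id_op_def intro!: prod.cong)

lemma comp_site_op_same:
  assumes "\<forall>l\<in>{1..N}. finite (B l)"
  shows "comp_op (tensor_basis N B) (site_op N B i Y) (site_op N B i Z) =
    site_op N B i (comp_op (B i) Y Z)"
  unfolding site_op_def comp_tensor_op[OF assms]
  by (rule tensor_op_cong) (auto simp: comp_op_id_left assms)

lemma comp_site_op_distinct:
  assumes "\<forall>l\<in>{1..N}. finite (B l)" "i \<noteq> j"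
  shows "comp_op (tensor_basis N B) (site_op N B i Y) (site_op N B j Z) =
    tensor_op N B (\<lambda>l. if l = i then Y else if l = j then Z else id_op (B l))"
  unfolding site_op_def comp_tensor_op[OF assms(1)]
  by (rule tensor_op_cong) (use assms in \<open>auto simp: comp_op_id_left comp_op_id_right\<close>)

lemma comp_site_op_commute:
  assumes "\<forall>l\<in>{1..N}. finite (B l)" "i \<noteq> j"
  shows "comp_op (tensor_basis N B) (site_op N B i Y) (site_op N B j Z) =
    comp_op (tensor_basis N B) (site_op N B j Z) (site_op N B i Y)"
  using assms(2) unfolding comp_site_op_distinct[OF assms] comp_site_op_distinct[OF assms(1) assms(2)[symmetric]]
  by (auto intro!: tensor_op_cong)

lemma comp_site_op_distinct_apply:
  assumes "\<forall>l\<in>{1..N}. finite (B l)" "i \<noteq> j" "i \<in> {1..N}" "j \<in> {1..N}"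
  shows "comp_op (tensor_basis N B) (site_op N B i Y) (site_op N B j Z) s t =
    (if s \<in> tensor_basis N B \<and> t \<in> tensor_basis N B
     then Y (s i) (t i) * Z (s j) (t j) * (\<Prod>l\<in>{1..N} - {i} - {j}. id_op (B l) (s l) (t l)) else 0)"
proof -
  have "j \<in> {1..N} - {i}" using assms by auto
  then show ?thesis
    unfolding comp_site_op_distinct[OF assms(1,2)] tensor_op_def
    using assms(2,3) by (simp add: prod.remove[of "{1..N}" i] prod.remove[of "{1..N} - {i}" j] del: One_nat_def)
qed

text \<open>\<open>X l a b\<close> is the matrix of the \<open>(a, b)\<close>-th matrix unit in the representation at site \<open>l\<close>.\<close>

locale gl_representations =
  fixes n N :: nat and B :: "nat \<Rightarrow> 'b set" and X :: "nat \<Rightarrow> nat \<Rightarrow> nat \<Rightarrow> 'b operator"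
  assumes finite_site: "l \<in> {1..N} \<Longrightarrow> finite (B l)"
    and unit_commutator: "l \<in> {1..N} \<Longrightarrow> a < n \<Longrightarrow> b < n \<Longrightarrow> c < n \<Longrightarrow> d < n \<Longrightarrow> s \<in> B l \<Longrightarrow> t \<in> B l \<Longrightarrow>
      bracket_op (B l) (X l a b) (X l c d) s t =
        (if b = c then X l a d s t else 0) - (if a = d then X l c b s t else 0)"
    and adjoint_unit: "l \<in> {1..N} \<Longrightarrow> a < n \<Longrightarrow> b < n \<Longrightarrow> adjoint_op (X l a b) = X l b a"
begin

section \<open>Casimir operators and the infinitesimal braid relations\<close>

abbreviation "TB \<equiv> tensor_basis N B"

definition unit_op :: "nat \<Rightarrow> nat \<Rightarrow> nat \<Rightarrow> (nat \<Rightarrow> 'b) operator"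
  where "unit_op i a b = site_op N B i (X i a b)"

text \<open>The split Casimir element, the sum of all \<open>E_ab \<otimes> E_ba\<close>, placed at
  sites \<open>i\<close> and \<open>j\<close>; it will be the operator of a chord.\<close>

definition casimir :: "nat \<Rightarrow> nat \<Rightarrow> (nat \<Rightarrow> 'b) operator"
  where "casimir i j = (\<Sum>a<n. \<Sum>b<n. comp_op TB (unit_op i a b) (unit_op j b a))"

lemma finite_sites: "\<forall>l\<in>{1..N}. finite (B l)"
  by (simp add: finite_site)

lemma finite_TB: "finite TB"
  unfolding tensor_basis_def by (rule finite_PiE) (auto simp: finite_site)

lemma bracket_unit_op_distinct: "i \<noteq> j \<Longrightarrow> bracket_op TB (unit_op i a b) (unit_op j c d) = 0"
  unfolding bracket_op_def unit_op_def by (subst comp_site_op_commute) (auto simp: finite_site)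

lemma bracket_unit_op_same:
  assumes "i \<in> {1..N}" "a < n" "b < n" "c < n" "d < n"
  shows "bracket_op TB (unit_op i a b) (unit_op i c d) =
    (if b = c then unit_op i a d else 0) - (if a = d then unit_op i c b else 0)"
proof -
  have "bracket_op TB (unit_op i a b) (unit_op i c d) =
    site_op N B i (bracket_op (B i) (X i a b) (X i c d))"
    unfolding bracket_op_def unit_op_def using assms(1)
    by (simp add: comp_site_op_same[OF finite_sites] site_op_linear)
  also have "\<dots> = site_op N B i ((if b = c then X i a d else 0) - (if a = d then X i c b else 0))"
    unfolding site_op_def
    by (rule tensor_op_cong) (use unit_commutator[OF assms] in auto)
  also have "\<dots> = (if b = c then unit_op i a d else 0) - (if a = d then unit_op i c b else 0)"
    using assms(1) by (simp add: site_op_linear unit_op_def del: diff_0 diff_0_right)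
  finally show ?thesis .
qed

text \<open>Operators at distinct sites commute, and renaming the summation indices restores the
  form.\<close>

lemma casimir_commute: "i \<noteq> j \<Longrightarrow> casimir i j = casimir j i"
  unfolding casimir_def unit_op_def
  by (subst sum.swap, subst comp_site_op_commute) (auto simp: finite_site)

lemma bracket_casimir_distinct:
  assumes "k \<noteq> i" "k \<noteq> j"
  shows "bracket_op TB (casimir i j) (unit_op k c d) = 0"
  using assms by (simp add: casimir_def bracket_op_linear bracket_op_comp bracket_unit_op_distinct
      comp_op_bilinear)

text \<open>The 4T relation is a sum of instances of this invariance of the Casimir element under the
  diagonal action on the two sites.\<close>

lemma bracket_casimir_diagonal:
  assumes "i \<in> {1..N}" "j \<in> {1..N}" "i \<noteq> j" "c < n" "d < n"
  shows "bracket_op TB (casimir i j) (unit_op i c d + unit_op j c d) = 0"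
proof -
  \<comment> \<open>\<open>?P\<close> and \<open>?Q\<close> come from the two terms of the
    commutator of matrix units. The brackets at the two sites produce them with opposite
    signs.\<close>
  let ?P = "\<Sum>a<n. comp_op TB (unit_op i a d) (unit_op j c a)"
  let ?Q = "\<Sum>b<n. comp_op TB (unit_op i c b) (unit_op j b d)"
  have [simp]: "comp_op TB (if P then Y else 0) Z = (if P then comp_op TB Y Z else 0)"
    "comp_op TB Z (if P then Y else 0) = (if P then comp_op TB Z Y else 0)" for P Y Z
    by (simp_all add: comp_op_bilinear)
  have "bracket_op TB (casimir i j) (unit_op i c d) =
    (\<Sum>a<n. \<Sum>b<n. (if b = c then comp_op TB (unit_op i a d) (unit_op j b a) else 0) -
      (if a = d then comp_op TB (unit_op i c b) (unit_op j b a) else 0))"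
    unfolding casimir_def bracket_op_linear bracket_op_comp
    using assms by (intro sum.cong refl)
      (simp add: bracket_unit_op_distinct bracket_unit_op_same comp_op_bilinear)
  also have "\<dots> = ?P - ?Q"
    using assms by (simp add: sum_subtractf sum.delta) (subst sum.swap, simp add: sum.delta)
  finally have 1: "bracket_op TB (casimir i j) (unit_op i c d) = ?P - ?Q" .
  have "bracket_op TB (casimir i j) (unit_op j c d) =
    (\<Sum>a<n. \<Sum>b<n. (if a = c then comp_op TB (unit_op i a b) (unit_op j b d) else 0) -
      (if b = d then comp_op TB (unit_op i a b) (unit_op j c a) else 0))"
    unfolding casimir_def bracket_op_linear bracket_op_comp
    using assms by (intro sum.cong refl)
      (simp add: bracket_unit_op_distinct bracket_unit_op_same comp_op_bilinear)
  also have "\<dots> = ?Q - ?P"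
    using assms by (simp add: sum_subtractf sum.delta) (subst sum.swap, simp add: sum.delta)
  finally show ?thesis unfolding bracket_op_linear 1 by simp
qed

text \<open>The second Casimir operator is built from operators at sites different from
  \<open>i\<close> and \<open>j\<close>, which commute with the first.\<close>

lemma casimir_2T:
  assumes "distinct [i, j, k, l]"
  shows "bracket_op TB (casimir i j) (casimir k l) = 0"
  unfolding casimir_def[of k l] using assms
  by (simp add: bracket_op_linear bracket_op_comp bracket_casimir_distinct comp_op_bilinear)

lemma casimir_4T:
  assumes "{i, j, k} \<subseteq> {1..N}" "distinct [i, j, k]"
  shows "bracket_op TB (casimir i j) (casimir i k + casimir j k) = 0"
proof -
  \<comment> \<open>Collecting the operator at site \<open>k\<close> leaves the diagonal action on
    sites \<open>i\<close> and \<open>j\<close> as the other factor.\<close>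
  have "casimir i k + casimir j k =
    (\<Sum>c<n. \<Sum>d<n. comp_op TB (unit_op i c d + unit_op j c d) (unit_op k d c))"
    unfolding casimir_def comp_op_bilinear by (simp only: sum.distrib)
  then show ?thesis using assms
    by (simp add: bracket_op_linear(2,3) bracket_op_comp bracket_casimir_distinct
        bracket_casimir_diagonal comp_op_bilinear(7,8) del: plus_fun_apply)
qed

text \<open>The adjoint reverses products and exchanges \<open>E_ab\<close> with
  \<open>E_ba\<close>, which gives the Casimir operator with its sites exchanged.\<close>

lemma adjoint_casimir:
  assumes "i \<in> {1..N}" "j \<in> {1..N}" "i \<noteq> j"
  shows "adjoint_op (casimir i j) = casimir i j"
proof -
  have "adjoint_op (casimir i j) = (\<Sum>a<n. \<Sum>b<n. comp_op TB (unit_op j a b) (unit_op i b a))"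
    unfolding casimir_def adjoint_op_sum adjoint_op_comp unit_op_def adjoint_site_op
    using assms by (simp add: adjoint_unit)
  then show ?thesis using casimir_commute[OF assms(3)] by (simp add: casimir_def)
qed

lemma casimir_apply:
  assumes "i \<in> {1..N}" "j \<in> {1..N}" "i \<noteq> j"
  shows "casimir i j s t = (if s \<in> TB \<and> t \<in> TB
    then (\<Sum>a<n. \<Sum>b<n. X i a b (s i) (t i) * X j b a (s j) (t j)) *
      (\<Prod>l\<in>{1..N} - {i} - {j}. id_op (B l) (s l) (t l)) else 0)"
  using assms unfolding casimir_def unit_op_def
  by (simp add: sum_operator_apply comp_site_op_distinct_apply[OF finite_sites] sum_distrib_right
      cong: if_cong) (auto intro: sum.neutral)

end

section \<open>From orthonormal bases to matrix units\<close>

text \<open>The completeness relation dual to orthonormality, obtained by expanding a matrix unit in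
  the basis \<open>e\<close>.\<close>

lemma orthonormal_basis_completeness:
  assumes "orthonormal_basis n e" "a < n" "b < n" "c < n" "d < n"
  shows "(\<Sum>r<n\<^sup>2. e r $$ (a, b) * e r $$ (c, d)) = (if a = d \<and> b = c then 1 else 0)"
proof -
  \<comment> \<open>The indices are transposed because the trace form pairs entry
    \<open>(d, c)\<close> with entry \<open>(c, d)\<close>: the coefficient of \<open>E\<close> at
    \<open>e s\<close> is then \<open>e s $$ (c, d)\<close>.\<close>
  define E :: "complex mat" where "E = mat n n (\<lambda>(i, j). if i = d \<and> j = c then 1 else 0)"
  have carr: "e r \<in> carrier_mat n n" if "r < n\<^sup>2" for r
    using assms(1) that by (auto simp: orthonormal_basis_def)
  have tr: "trace_form n P Q = (\<Sum>i<n. \<Sum>j<n. P $$ (i, j) * Q $$ (j, i))"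
    if "P \<in> carrier_mat n n" "Q \<in> carrier_mat n n" for P Q
    using that by (simp add: trace_form_def scalar_prod_def atLeast0LessThan)
  have "E \<in> carrier_mat n n" by (simp add: E_def)
  then obtain x where x: "E = mat n n (\<lambda>(i, j). \<Sum>r<n\<^sup>2. x r * e r $$ (i, j))"
    using assms(1) by (auto simp: orthonormal_basis_def)
  have coeff: "x s = e s $$ (c, d)" if "s < n\<^sup>2" for s
  proof -
    have "trace_form n E (e s) = (\<Sum>i<n. \<Sum>j<n. \<Sum>r<n\<^sup>2. x r * (e r $$ (i, j) * e s $$ (j, i)))"
      using carr[OF that] \<open>E \<in> _\<close> by (simp add: tr) (simp add: x sum_distrib_right mult.assoc)
    also have "\<dots> = (\<Sum>r<n\<^sup>2. x r * trace_form n (e r) (e s))"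
      using carr that by (simp add: tr sum_distrib_left)
        (subst sum.swap, simp add: sum.swap[of _ "{..<n\<^sup>2}"])
    also have "\<dots> = x s"
      using assms(1) that by (simp add: orthonormal_basis_def if_distrib[of "\<lambda>y. _ * y"] cong: if_cong)
    finally have "x s = trace_form n E (e s)" ..
    also have "\<dots> = (\<Sum>i<n. \<Sum>j<n. if i = d then (if j = c then e s $$ (j, i) else 0) else 0)"
      using carr[OF that] \<open>E \<in> _\<close> by (simp add: tr) (auto simp: E_def intro!: sum.cong)
    also have "\<dots> = e s $$ (c, d)"
      using assms(4,5) by (subst sum.swap) (simp add: sum.delta)
    finally show ?thesis .
  qed
  have "(\<Sum>r<n\<^sup>2. e r $$ (a, b) * e r $$ (c, d)) = E $$ (a, b)"
    using assms(2,3) by (simp add: x coeff mult.commute)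
  then show ?thesis using assms(2,3) by (simp add: E_def)
qed

text \<open>Moving the sum over \<open>r\<close> inside leaves the completeness kernel, which forces
  the second index pair to be the swap of the first.\<close>

lemma orthonormal_basis_contract:
  assumes "orthonormal_basis n e"
  shows "(\<Sum>r<n\<^sup>2. (\<Sum>a<n. \<Sum>b<n. e r $$ (a, b) * Y a b) * (\<Sum>c<n. \<Sum>d<n. e r $$ (c, d) * Z c d)) =
    (\<Sum>a<n. \<Sum>b<n. Y a b * Z b a :: complex)"
proof -
  let ?Q = "{..<n} \<times> {..<n}"
  let ?y = "\<lambda>p. Y (fst p) (snd p)" and ?z = "\<lambda>p. Z (fst p) (snd p)"
  have "(\<Sum>r<n\<^sup>2. (\<Sum>a<n. \<Sum>b<n. e r $$ (a, b) * Y a b) * (\<Sum>c<n. \<Sum>d<n. e r $$ (c, d) * Z c d)) =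
    (\<Sum>r<n\<^sup>2. (\<Sum>p\<in>?Q. e r $$ p * ?y p) * (\<Sum>q\<in>?Q. e r $$ q * ?z q))"
    by (simp add: sum.cartesian_product case_prod_unfold)
  also have "\<dots> = (\<Sum>r<n\<^sup>2. \<Sum>p\<in>?Q. \<Sum>q\<in>?Q. ?y p * ?z q * (e r $$ p * e r $$ q))"
    by (simp add: sum_product mult_ac)
  also have "\<dots> = (\<Sum>p\<in>?Q. \<Sum>q\<in>?Q. ?y p * ?z q * (\<Sum>r<n\<^sup>2. e r $$ p * e r $$ q))"
    unfolding sum_distrib_left by (subst sum.swap, intro sum.cong refl, rule sum.swap)
  also have "\<dots> = (\<Sum>p\<in>?Q. \<Sum>q\<in>?Q. if q = prod.swap p then ?y p * ?z q else 0)"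
    by (intro sum.cong refl) (auto simp: orthonormal_basis_completeness[OF assms])
  also have "\<dots> = (\<Sum>p\<in>?Q. ?y p * ?z (prod.swap p))"
    by (intro sum.cong refl) (auto simp: sum.delta)
  also have "\<dots> = (\<Sum>a<n. \<Sum>b<n. Y a b * Z b a)"
    by (simp add: sum.cartesian_product case_prod_unfold)
  finally show ?thesis .
qed

text \<open>Both actions are linear in the entries of \<open>e r\<close>, so summing over
  \<open>r\<close> is the contraction above. The right-hand side does not involve \<open>e\<close>,
  which shows independence of the orthonormal basis.\<close>

lemma (in gl_representations) chord_op_eq_casimir:
  assumes "orthonormal_basis n e" "i \<in> {1..N}" "j \<in> {1..N}" "i \<noteq> j"
    and "\<And>l. l \<in> {1..N} \<Longrightarrow> basis (\<rho> l) = B l"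
    and "\<And>l A s t. l \<in> {1..N} \<Longrightarrow> A \<in> carrier_mat n n \<Longrightarrow> s \<in> B l \<Longrightarrow> t \<in> B l \<Longrightarrow>
      action (\<rho> l) A s t = (\<Sum>a<n. \<Sum>b<n. A $$ (a, b) * X l a b s t)"
  shows "chord_op n N e \<rho> i j = casimir i j"
proof (intro ext)
  fix s t
  have TB: "tensor_basis N (\<lambda>l. basis (\<rho> l)) = TB"
    unfolding tensor_basis_def using assms(5) by (intro PiE_cong) auto
  have carr: "e r \<in> carrier_mat n n" if "r < n\<^sup>2" for r
    using assms(1) that by (auto simp: orthonormal_basis_def)
  let ?P = "\<Prod>l\<in>{1..N} - {i} - {j}. id_op (B l) (s l) (t l)"
  have summand: "tensor_op N (\<lambda>l. basis (\<rho> l))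
      (\<lambda>l. if l = i \<or> l = j then action (\<rho> l) A else id_op (basis (\<rho> l))) s t =
    (if s \<in> TB \<and> t \<in> TB then action (\<rho> i) A (s i) (t i) * action (\<rho> j) A (s j) (t j) * ?P else 0)" for A
  proof -
    have j: "j \<in> {1..N} - {i}" using assms by auto
    have "(\<Prod>l\<in>{1..N} - {i} - {j}. (if l = i \<or> l = j then action (\<rho> l) A else id_op (basis (\<rho> l))) (s l) (t l)) = ?P"
      by (intro prod.cong) (auto simp: assms(5))
    then show ?thesis unfolding tensor_op_def TB
      using assms(2) j by (simp add: prod.remove[of "{1..N}" i] prod.remove[of "{1..N} - {i}" j] del: One_nat_def)
  qed
  show "chord_op n N e \<rho> i j s t = casimir i j s t"
  proof (cases "s \<in> TB \<and> t \<in> TB")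
    case True
    then have "s l \<in> B l" "t l \<in> B l" if "l \<in> {1..N}" for l
      using that PiE_mem[of _ "{1..N}" B l] by (simp_all only: tensor_basis_def)
    then have "chord_op n N e \<rho> i j s t = (\<Sum>r<n\<^sup>2.
        (\<Sum>a<n. \<Sum>b<n. e r $$ (a, b) * X i a b (s i) (t i)) *
        (\<Sum>a<n. \<Sum>b<n. e r $$ (a, b) * X j a b (s j) (t j)) * ?P)"
      unfolding chord_op_def summand using True assms(2,3,6) carr by (intro sum.cong) auto
    also have "\<dots> = (\<Sum>a<n. \<Sum>b<n. X i a b (s i) (t i) * X j b a (s j) (t j)) * ?P"
      using orthonormal_basis_contract[OF assms(1), of "\<lambda>a b. X i a b (s i) (t i)"
          "\<lambda>a b. X j a b (s j) (t j)"]
      by (simp only: flip: sum_distrib_right)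
    finally show ?thesis using True by (simp only: casimir_apply[OF assms(2-4)] simp_thms if_True)
  qed (auto simp: chord_op_def summand casimir_apply[OF assms(2-4)])
qed

section \<open>The chord algebra\<close>

lemma diagram_ring_simps [simp]:
  "carrier (diagram_ring N) = {x. Poly_Mapping.keys x \<subseteq> horizontal_diagrams N}"
  "x \<otimes>\<^bsub>diagram_ring N\<^esub> y = x * y" "\<one>\<^bsub>diagram_ring N\<^esub> = 1"
  "\<zero>\<^bsub>diagram_ring N\<^esub> = 0" "x \<oplus>\<^bsub>diagram_ring N\<^esub> y = x + y"
  by (simp_all add: diagram_ring_def)

lemma horizontal_diagrams_closed:
  "0 \<in> horizontal_diagrams N"
  "d \<in> horizontal_diagrams N \<Longrightarrow> d' \<in> horizontal_diagrams N \<Longrightarrow> d + d' \<in> horizontal_diagrams N"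
  "d \<in> horizontal_diagrams N \<Longrightarrow> rev_diagram d \<in> horizontal_diagrams N"
  by (auto simp: horizontal_diagrams_def zero_diagram_def plus_diagram_def rev_diagram_def)

lemma diagram_carrier_closed:
  shows "x \<in> carrier (diagram_ring N) \<Longrightarrow> y \<in> carrier (diagram_ring N) \<Longrightarrow> x + y \<in> carrier (diagram_ring N)"
    and "x \<in> carrier (diagram_ring N) \<Longrightarrow> y \<in> carrier (diagram_ring N) \<Longrightarrow> x * y \<in> carrier (diagram_ring N)"
    and "x \<in> carrier (diagram_ring N) \<Longrightarrow> - x \<in> carrier (diagram_ring N)"
    and "x \<in> carrier (diagram_ring N) \<Longrightarrow> y \<in> carrier (diagram_ring N) \<Longrightarrow> x - y \<in> carrier (diagram_ring N)"
    and "1 \<in> carrier (diagram_ring N)" "0 \<in> carrier (diagram_ring N)"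
proof -
  assume x: "x \<in> carrier (diagram_ring N)"
  show uminus: "- y \<in> carrier (diagram_ring N)" if "y \<in> carrier (diagram_ring N)" for y
    using that by (auto simp: in_keys_iff)
  assume y: "y \<in> carrier (diagram_ring N)"
  show add: "x + y \<in> carrier (diagram_ring N)" if "y \<in> carrier (diagram_ring N)" for y
    using x that Poly_Mapping.keys_add[of x y] by auto
  show "x - y \<in> carrier (diagram_ring N)" using add[OF uminus[OF y]] by simp
  show "x * y \<in> carrier (diagram_ring N)"
    using x y by (auto dest!: subsetD[OF keys_mult] intro!: horizontal_diagrams_closed(2))
qed (use horizontal_diagrams_closed(1) in simp_all)

lemma ring_diagram_ring: "ring (diagram_ring N)"
proof (rule ringI)
  show "abelian_group (diagram_ring N)"
  proof (rule abelian_groupI)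
    fix x assume "x \<in> carrier (diagram_ring N)"
    then show "\<exists>y\<in>carrier (diagram_ring N). y \<oplus>\<^bsub>diagram_ring N\<^esub> x = \<zero>\<^bsub>diagram_ring N\<^esub>"
      using diagram_carrier_closed(3) by (intro bexI[of _ "- x"]) auto
  qed (use diagram_carrier_closed(1) in \<open>auto simp: add_ac\<close>)
  show "Group.monoid (diagram_ring N)"
    using diagram_carrier_closed(2,5)
    by (intro monoidI) (auto simp: mult.assoc)
qed (auto simp: algebra_simps)

text \<open>Closure under additive inverses follows from absorption, as \<open>- x\<close> is
  \<open>- 1 * x\<close>.\<close>

lemma ideal_diagram_ringI:
  assumes "J \<subseteq> carrier (diagram_ring N)" "0 \<in> J"
    and "\<And>x y. x \<in> J \<Longrightarrow> y \<in> J \<Longrightarrow> x + y \<in> J"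
    and "\<And>x y. x \<in> J \<Longrightarrow> y \<in> carrier (diagram_ring N) \<Longrightarrow> x * y \<in> J"
    and "\<And>x y. x \<in> J \<Longrightarrow> y \<in> carrier (diagram_ring N) \<Longrightarrow> y * x \<in> J"
  shows "ideal J (diagram_ring N)"
proof (rule idealI[OF ring_diagram_ring])
  interpret R: ring "diagram_ring N" by (rule ring_diagram_ring)
  show "subgroup J (add_monoid (diagram_ring N))"
  proof (rule group.subgroupI)
    fix x assume x: "x \<in> J"
    then have "\<ominus>\<^bsub>diagram_ring N\<^esub> x = - 1 * x"
      using assms(1) diagram_carrier_closed(3)[of x N] by (intro R.minus_equality) auto
    moreover have "- 1 * x \<in> J"
      using assms(5)[OF x] diagram_carrier_closed(3,5) by blast
    ultimately show "inv\<^bsub>add_monoid (diagram_ring N)\<^esub> x \<in> J" by (simp add: a_inv_def)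
  qed (use assms R.add.is_group in auto)
qed (use assms in auto)

text \<open>Scalars are multiples of the empty diagram, so facts about products also cover scalar
  multiplication.\<close>

lemma diagram_smult_eq_mult: "diagram_smult c x = Poly_Mapping.single 0 c * x"
  unfolding diagram_smult_def by (rule mult_map_scale_conv_mult)

lemma diagram_smult_closed:
  "x \<in> carrier (diagram_ring N) \<Longrightarrow> diagram_smult c x \<in> carrier (diagram_ring N)"
  unfolding diagram_smult_eq_mult
  by (rule diagram_carrier_closed) (auto simp: horizontal_diagrams_closed)

lemma rev_diagram_simps [simp]:
  "rev_diagram (rev_diagram d) = d" "rev_diagram 0 = 0" "rev_diagram (d + d') = rev_diagram d' + rev_diagram d"
  by (simp_all add: rev_diagram_def zero_diagram_def plus_diagram_def)

text \<open>Reversal is an involution, so at most one summand contributes to a given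
  coefficient.\<close>

lemma lookup_diagram_star:
  "Poly_Mapping.lookup (diagram_star x) d = cnj (Poly_Mapping.lookup x (rev_diagram d))"
proof -
  have "rev_diagram d' = d \<longleftrightarrow> d' = rev_diagram d" for d' by auto
  then show ?thesis
    by (auto simp: diagram_star_def lookup_sum lookup_single when_def in_keys_iff)
qed

lemma diagram_star_simps:
  "diagram_star (x + y) = diagram_star x + diagram_star y"
  "diagram_star (- x) = - diagram_star x"
  "diagram_star (x - y) = diagram_star x - diagram_star y"
  "diagram_star (diagram_star x) = x"
  "diagram_star 0 = 0"
  "diagram_star (Poly_Mapping.single d c) = Poly_Mapping.single (rev_diagram d) (cnj c)"
proof -
  have "rev_diagram d' = d \<longleftrightarrow> d' = rev_diagram d" for d' by auto
  then show "diagram_star (Poly_Mapping.single d c) = Poly_Mapping.single (rev_diagram d) (cnj c)"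
    by (auto intro!: poly_mapping_eqI simp: lookup_diagram_star lookup_single when_def)
qed (auto intro!: poly_mapping_eqI simp: lookup_diagram_star lookup_add lookup_minus)

text \<open>Every element is a finite sum of monomials, so additive identities need checking on
  monomials only.\<close>

lemma poly_mapping_single_induct [case_names zero single add]:
  assumes "P 0" "\<And>d c. P (Poly_Mapping.single d c)" "\<And>x y. P x \<Longrightarrow> P y \<Longrightarrow> P (x + y)"
  shows "P (x :: 'a \<Rightarrow>\<^sub>0 'b::comm_monoid_add)"
proof -
  have "x = (\<Sum>d\<in>Poly_Mapping.keys x. Poly_Mapping.single d (Poly_Mapping.lookup x d))"
    by (rule poly_mapping_eqI) (auto simp: lookup_sum lookup_single when_def in_keys_iff)
  moreover have "P (\<Sum>d\<in>K. Poly_Mapping.single d (f d))" for f and K :: "'a set"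
    by (induction K rule: infinite_finite_induct) (auto intro: assms)
  ultimately show ?thesis by metis
qed

lemma single_zero_central: "x * Poly_Mapping.single 0 c = Poly_Mapping.single 0 c * (x :: 'a::monoid_add \<Rightarrow>\<^sub>0 complex)"
  by (induction x rule: poly_mapping_single_induct) (simp_all add: distrib_left distrib_right mult_single mult.commute)

lemma diagram_star_mult: "diagram_star (x * y) = diagram_star y * diagram_star x"
proof (induction x rule: poly_mapping_single_induct)
  case (single d c)
  show ?case
    by (induction y rule: poly_mapping_single_induct)
      (auto simp: diagram_star_simps mult_single distrib_left distrib_right mult.commute)
qed (simp_all add: diagram_star_simps distrib_left distrib_right)

lemma diagram_star_closed:
  "x \<in> carrier (diagram_ring N) \<Longrightarrow> diagram_star x \<in> carrier (diagram_ring N)"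
  using horizontal_diagrams_closed(3)[of "rev_diagram _" N]
  by (auto simp: in_keys_iff lookup_diagram_star)

lemma chord_closed:
  "i \<in> {1..N} \<Longrightarrow> j \<in> {1..N} \<Longrightarrow> i \<noteq> j \<Longrightarrow> chord i j \<in> carrier (diagram_ring N)"
  by (auto simp: chord_def horizontal_diagrams_def min_def max_def)

lemma diagram_star_chord: "diagram_star (chord i j) = chord i j"
  by (simp add: chord_def diagram_star_simps rev_diagram_def)

section \<open>The braid ideal\<close>

lemma relations_closed: "relations_2T N \<union> relations_4T N \<subseteq> carrier (diagram_ring N)"
  unfolding relations_2T_def relations_4T_def
  by (auto intro!: diagram_carrier_closed chord_closed simp del: diagram_ring_simps)

lemma ideal_braid_ideal: "ideal (braid_ideal N) (diagram_ring N)"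
  unfolding braid_ideal_def by (rule ring.genideal_ideal[OF ring_diagram_ring relations_closed])

text \<open>Serves to show that the ideal is stable under the star and that the weight homomorphism
  kills it.\<close>

lemma braid_ideal_minimal:
  "ideal J (diagram_ring N) \<Longrightarrow> relations_2T N \<union> relations_4T N \<subseteq> J \<Longrightarrow> braid_ideal N \<subseteq> J"
  unfolding braid_ideal_def by (rule ring.genideal_minimal[OF ring_diagram_ring])

lemma braid_ideal_closed:
  assumes "x \<in> braid_ideal N"
  shows "x \<in> carrier (diagram_ring N)"
    and "y \<in> braid_ideal N \<Longrightarrow> x + y \<in> braid_ideal N"
    and "y \<in> carrier (diagram_ring N) \<Longrightarrow> x * y \<in> braid_ideal N"
    and "y \<in> carrier (diagram_ring N) \<Longrightarrow> y * x \<in> braid_ideal N"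
proof -
  interpret I: ideal "braid_ideal N" "diagram_ring N" by (rule ideal_braid_ideal)
  show "x \<in> carrier (diagram_ring N)" using I.Icarr[OF assms] .
  show "y \<in> braid_ideal N \<Longrightarrow> x + y \<in> braid_ideal N"
    using additive_subgroup.a_closed[OF I.additive_subgroup_axioms assms] by simp
  show "y \<in> carrier (diagram_ring N) \<Longrightarrow> x * y \<in> braid_ideal N"
    using I.I_r_closed[OF assms, of y] by simp
  show "y \<in> carrier (diagram_ring N) \<Longrightarrow> y * x \<in> braid_ideal N"
    using I.I_l_closed[OF assms, of y] by simp
qed

lemma zero_in_braid_ideal: "0 \<in> braid_ideal N"
  using additive_subgroup.zero_closed[OF ideal.axioms(1)[OF ideal_braid_ideal]] by simp

lemma diagram_smult_braid_ideal: "x \<in> braid_ideal N \<Longrightarrow> diagram_smult c x \<in> braid_ideal N"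
  unfolding diagram_smult_eq_mult
  by (erule braid_ideal_closed) (auto simp: horizontal_diagrams_closed)

lemma uminus_braid_ideal: "x \<in> braid_ideal N \<Longrightarrow> - x \<in> braid_ideal N"
  using diagram_smult_braid_ideal[of x N "- 1"] by (simp add: diagram_smult_eq_mult single_uminus)

text \<open>The preimage of the ideal under the star is again an ideal. It contains the relations
  because the star fixes chords and reverses products, and so sends every relation to its
  negative.\<close>

lemma diagram_star_braid_ideal:
  assumes "x \<in> braid_ideal N"
  shows "diagram_star x \<in> braid_ideal N"
proof -
  let ?J = "{x \<in> carrier (diagram_ring N). diagram_star x \<in> braid_ideal N}"
  have "ideal ?J (diagram_ring N)"
    using diagram_star_closed
    by (intro ideal_diagram_ringI)
      (auto simp: diagram_star_simps diagram_star_mult zero_in_braid_ideal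
        intro: braid_ideal_closed(2-4) diagram_carrier_closed simp del: diagram_ring_simps)
  moreover have "relations_2T N \<union> relations_4T N \<subseteq> ?J"
  proof
    fix x assume x: "x \<in> relations_2T N \<union> relations_4T N"
    then have "diagram_star x = - x"
      by (auto simp: relations_2T_def relations_4T_def diagram_star_simps diagram_star_mult
          diagram_star_chord)
    moreover have "x \<in> braid_ideal N"
      using ring.genideal_self[OF ring_diagram_ring relations_closed] x by (auto simp: braid_ideal_def)
    ultimately show "x \<in> ?J" using x relations_closed uminus_braid_ideal by auto
  qed
  ultimately have "braid_ideal N \<subseteq> ?J" by (rule braid_ideal_minimal)
  then show ?thesis using assms by blast
qed

section \<open>The quotient star-algebra\<close>

abbreviation braid_coset :: "nat \<Rightarrow> (diagram \<Rightarrow>\<^sub>0 complex) \<Rightarrow> (diagram \<Rightarrow>\<^sub>0 complex) set"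
  where "braid_coset N x \<equiv> braid_ideal N +>\<^bsub>diagram_ring N\<^esub> x"

lemma braid_coset_eq: "braid_coset N x = {h + x | h. h \<in> braid_ideal N}"
  by (auto simp: a_r_coset_def')

lemma braid_coset_absorb:
  assumes "h \<in> braid_ideal N"
  shows "braid_coset N (h + x) = braid_coset N x"
proof -
  have "\<exists>h''. h' + (h + x) = h'' + x \<and> h'' \<in> braid_ideal N" if "h' \<in> braid_ideal N" for h'
    using braid_ideal_closed(2)[OF that assms] by (intro exI[of _ "h' + h"]) (simp add: add_ac)
  moreover have "\<exists>h''. h' + x = h'' + (h + x) \<and> h'' \<in> braid_ideal N" if "h' \<in> braid_ideal N" for h'
    using braid_ideal_closed(2)[OF that uminus_braid_ideal[OF assms]]
    by (intro exI[of _ "h' + - h"]) (simp add: add_ac)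
  ultimately show ?thesis unfolding braid_coset_eq by blast
qed

text \<open>An additive map preserving the ideal is constant modulo the ideal on each coset, so the
  union consists of a single coset. This applies to scalar multiplication and to the star.\<close>

lemma Union_braid_coset:
  assumes "\<And>x y. f (x + y) = f x + f y" "\<And>h. h \<in> braid_ideal N \<Longrightarrow> f h \<in> braid_ideal N"
  shows "(\<Union>y\<in>braid_coset N x. braid_coset N (f y)) = braid_coset N (f x)"
proof -
  have "braid_coset N (f y) = braid_coset N (f x)" if "y \<in> braid_coset N x" for y
    using that by (auto simp: braid_coset_eq[of N x] assms braid_coset_absorb)
  moreover have "x \<in> braid_coset N x" using zero_in_braid_ideal by (force simp: braid_coset_eq)
  ultimately show ?thesis by blast
qed

text \<open>Reduces the operations of the quotient to representatives, and thereby the star-algebra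
  axioms to identities in the monoid algebra.\<close>

lemma chord_algebra_simps:
  shows "carrier (chord_algebra N) = braid_coset N ` carrier (diagram_ring N)"
    and "\<one>\<^bsub>chord_algebra N\<^esub> = braid_coset N 1"
    and "\<zero>\<^bsub>chord_algebra N\<^esub> = braid_coset N 0"
    and "c \<odot>\<^bsub>chord_algebra N\<^esub> braid_coset N x = braid_coset N (diagram_smult c x)"
    and "star (chord_algebra N) (braid_coset N x) = braid_coset N (diagram_star x)"
    and "x \<in> carrier (diagram_ring N) \<Longrightarrow> y \<in> carrier (diagram_ring N) \<Longrightarrow>
      braid_coset N x \<otimes>\<^bsub>chord_algebra N\<^esub> braid_coset N y = braid_coset N (x * y)"
    and "x \<in> carrier (diagram_ring N) \<Longrightarrow> y \<in> carrier (diagram_ring N) \<Longrightarrow>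
      braid_coset N x \<oplus>\<^bsub>chord_algebra N\<^esub> braid_coset N y = braid_coset N (x + y)"
proof -
  interpret I: ideal "braid_ideal N" "diagram_ring N" by (rule ideal_braid_ideal)
  show "carrier (chord_algebra N) = braid_coset N ` carrier (diagram_ring N)"
    by (auto simp: chord_algebra_def Let_def FactRing_def A_RCOSETS_def')
  show "\<one>\<^bsub>chord_algebra N\<^esub> = braid_coset N 1"
    by (simp add: chord_algebra_def Let_def FactRing_def)
  show "\<zero>\<^bsub>chord_algebra N\<^esub> = braid_coset N 0"
    by (auto simp: chord_algebra_def Let_def FactRing_def braid_coset_eq)
  show "c \<odot>\<^bsub>chord_algebra N\<^esub> braid_coset N x = braid_coset N (diagram_smult c x)"
    using Union_braid_coset[of "diagram_smult c" N x]
    by (simp add: chord_algebra_def Let_def diagram_smult_braid_ideal)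
      (simp add: diagram_smult_eq_mult distrib_left)
  show "star (chord_algebra N) (braid_coset N x) = braid_coset N (diagram_star x)"
    using Union_braid_coset[of diagram_star N x]
    by (simp add: chord_algebra_def Let_def diagram_star_braid_ideal diagram_star_simps)
  assume xy: "x \<in> carrier (diagram_ring N)" "y \<in> carrier (diagram_ring N)"
  show "braid_coset N x \<otimes>\<^bsub>chord_algebra N\<^esub> braid_coset N y = braid_coset N (x * y)"
    using I.rcoset_mult_add[OF xy] by (simp add: chord_algebra_def Let_def FactRing_def)
  show "braid_coset N x \<oplus>\<^bsub>chord_algebra N\<^esub> braid_coset N y = braid_coset N (x + y)"
    using I.a_rcos_sum[OF xy] by (simp add: chord_algebra_def Let_def FactRing_def)
qed

lemma complex_star_algebra_chord_algebra: "complex_star_algebra (chord_algebra N)"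
proof -
  note simps = chord_algebra_simps diagram_carrier_closed diagram_smult_closed diagram_star_closed
  \<comment> \<open>Carrier membership must stay folded for the closure lemmas to apply.\<close>
  note [simp del] = diagram_ring_simps
  have "ring (chord_algebra N)"
  proof (rule ringI)
    show "abelian_group (chord_algebra N)"
    proof (rule abelian_groupI)
      fix x assume "x \<in> carrier (chord_algebra N)"
      then obtain y where y: "y \<in> carrier (diagram_ring N)" "x = braid_coset N y"
        by (auto simp: chord_algebra_simps)
      then show "\<exists>z\<in>carrier (chord_algebra N). z \<oplus>\<^bsub>chord_algebra N\<^esub> x = \<zero>\<^bsub>chord_algebra N\<^esub>"
        by (intro bexI[of _ "braid_coset N (- y)"]) (auto simp: simps)
    qed (auto simp: simps add_ac)
    show "Group.monoid (chord_algebra N)"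
      by (rule monoidI) (auto simp: simps mult.assoc)
  qed (auto simp: simps algebra_simps)
  moreover have "complex_star_algebra_axioms (chord_algebra N)"
  proof
    fix c d x y assume "x \<in> carrier (chord_algebra N)" "y \<in> carrier (chord_algebra N)"
    then obtain u v where u: "u \<in> carrier (diagram_ring N)" "x = braid_coset N u"
      and v: "v \<in> carrier (diagram_ring N)" "y = braid_coset N v"
      by (auto simp: chord_algebra_simps)
    note star = diagram_star_simps diagram_star_mult
    show "c \<odot>\<^bsub>chord_algebra N\<^esub> (x \<oplus>\<^bsub>chord_algebra N\<^esub> y) =
      c \<odot>\<^bsub>chord_algebra N\<^esub> x \<oplus>\<^bsub>chord_algebra N\<^esub> c \<odot>\<^bsub>chord_algebra N\<^esub> y"
      using u v by (simp add: simps) (simp add: diagram_smult_eq_mult distrib_left)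
    show "(c \<odot>\<^bsub>chord_algebra N\<^esub> x) \<otimes>\<^bsub>chord_algebra N\<^esub> y =
      c \<odot>\<^bsub>chord_algebra N\<^esub> (x \<otimes>\<^bsub>chord_algebra N\<^esub> y)"
      using u v by (simp add: simps) (simp add: diagram_smult_eq_mult mult.assoc)
    show "x \<otimes>\<^bsub>chord_algebra N\<^esub> (c \<odot>\<^bsub>chord_algebra N\<^esub> y) =
      c \<odot>\<^bsub>chord_algebra N\<^esub> (x \<otimes>\<^bsub>chord_algebra N\<^esub> y)"
      using u v by (simp add: simps)
        (metis diagram_smult_eq_mult mult.assoc single_zero_central)
    show "star (chord_algebra N) (x \<otimes>\<^bsub>chord_algebra N\<^esub> y) =
      star (chord_algebra N) y \<otimes>\<^bsub>chord_algebra N\<^esub> star (chord_algebra N) x"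
      using u v by (simp add: simps star)
    show "star (chord_algebra N) (c \<odot>\<^bsub>chord_algebra N\<^esub> x \<oplus>\<^bsub>chord_algebra N\<^esub> d \<odot>\<^bsub>chord_algebra N\<^esub> y) =
      cnj c \<odot>\<^bsub>chord_algebra N\<^esub> star (chord_algebra N) x \<oplus>\<^bsub>chord_algebra N\<^esub>
        cnj d \<odot>\<^bsub>chord_algebra N\<^esub> star (chord_algebra N) y"
      using u v by (simp add: simps) (simp add: diagram_smult_eq_mult star single_zero_central)
  next
    fix c d x assume "x \<in> carrier (chord_algebra N)"
    then obtain u where u: "u \<in> carrier (diagram_ring N)" "x = braid_coset N u"
      by (auto simp: chord_algebra_simps)
    show "c \<odot>\<^bsub>chord_algebra N\<^esub> x \<in> carrier (chord_algebra N)"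
      "star (chord_algebra N) x \<in> carrier (chord_algebra N)"
      "star (chord_algebra N) (star (chord_algebra N) x) = x"
      using u by (simp_all add: simps diagram_star_simps)
    show "(c + d) \<odot>\<^bsub>chord_algebra N\<^esub> x =
      c \<odot>\<^bsub>chord_algebra N\<^esub> x \<oplus>\<^bsub>chord_algebra N\<^esub> d \<odot>\<^bsub>chord_algebra N\<^esub> x"
      using u by (simp add: simps) (simp add: diagram_smult_eq_mult distrib_right single_add)
    show "(c * d) \<odot>\<^bsub>chord_algebra N\<^esub> x = c \<odot>\<^bsub>chord_algebra N\<^esub> (d \<odot>\<^bsub>chord_algebra N\<^esub> x)"
      "1 \<odot>\<^bsub>chord_algebra N\<^esub> x = x"
      using u by (simp_all add: simps)
        (simp_all add: diagram_smult_eq_mult mult.assoc[symmetric] mult_single)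
  next
    show "star (chord_algebra N) \<one>\<^bsub>chord_algebra N\<^esub> = \<one>\<^bsub>chord_algebra N\<^esub>"
      using diagram_star_simps(6)[of 0 1] by (simp add: simps)
  qed
  ultimately show ?thesis by (rule complex_star_algebra.intro)
qed

section \<open>Positivity of the weight system\<close>

text \<open>Collects what the positivity argument uses of the representations; exterior powers enter
  only when the locale is interpreted.\<close>

locale gl_weight_system = gl_representations n N B X
  for n N :: nat and B :: "nat \<Rightarrow> 'b set" and X :: "nat \<Rightarrow> nat \<Rightarrow> nat \<Rightarrow> 'b operator" +
  fixes e :: "nat \<Rightarrow> complex mat" and \<rho> :: "nat \<Rightarrow> 'b representation"
  assumes orthonormal: "orthonormal_basis n e"
    and basis_site: "l \<in> {1..N} \<Longrightarrow> basis (\<rho> l) = B l"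
    and action_site: "l \<in> {1..N} \<Longrightarrow> A \<in> carrier_mat n n \<Longrightarrow> s \<in> B l \<Longrightarrow> t \<in> B l \<Longrightarrow>
      action (\<rho> l) A s t = (\<Sum>a<n. \<Sum>b<n. A $$ (a, b) * X l a b s t)"
begin

abbreviation "D \<equiv> diagram_op n N e \<rho>"
abbreviation "W \<equiv> free_weight_hom n N e \<rho>"

section \<open>Operators of diagrams\<close>

lemma tensor_basis_eq: "tensor_basis N (\<lambda>l. basis (\<rho> l)) = TB"
  unfolding tensor_basis_def by (intro PiE_cong basis_site)

lemma diagram_op_Nil: "D (Diagram []) = id_op TB"
  by (simp add: diagram_op_def tensor_basis_eq)

lemma diagram_op_Cons: "D (Diagram ((i, j) # cs)) = comp_op TB (chord_op n N e \<rho> i j) (D (Diagram cs))"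
  by (simp add: diagram_op_def tensor_basis_eq Let_def)

lemma chord_op_outside: "s \<notin> TB \<or> t \<notin> TB \<Longrightarrow> chord_op n N e \<rho> i j s t = 0"
  unfolding chord_op_def tensor_op_def tensor_basis_eq by auto

text \<open>Makes \<open>id_op TB\<close> a genuine left unit for diagram operators, as the base
  case of multiplicativity requires.\<close>

lemma diagram_op_outside: "s \<notin> TB \<Longrightarrow> D d s t = 0"
proof (cases d)
  fix cs assume "s \<notin> TB" "d = Diagram cs"
  then show ?thesis
    by (cases cs) (auto simp: diagram_op_Nil diagram_op_Cons id_op_def comp_op_def chord_op_outside)
qed

lemma comp_id_diagram_op: "comp_op TB (id_op TB) (D d) = D d"
proof (intro ext)
  fix s t
  show "comp_op TB (id_op TB) (D d) s t = D d s t"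
    by (cases "s \<in> TB") (simp add: comp_op_id_left finite_TB, simp add: comp_op_def id_op_def diagram_op_outside)
qed

lemma diagram_op_plus: "D (d + d') = comp_op TB (D d) (D d')"
proof -
  have "D (Diagram (cs @ cs')) = comp_op TB (D (Diagram cs)) (D (Diagram cs'))" for cs cs'
    by (induction cs) (auto simp: diagram_op_Nil diagram_op_Cons comp_id_diagram_op comp_op_assoc)
  then show ?thesis by (cases d; cases d') (simp add: plus_diagram_def)
qed

lemma diagram_op_single: "D (Diagram [(i, j)]) = chord_op n N e \<rho> i j"
proof (intro ext)
  fix s t
  show "D (Diagram [(i, j)]) s t = chord_op n N e \<rho> i j s t"
    unfolding diagram_op_Cons diagram_op_Nil
    by (cases "t \<in> TB") (simp add: comp_op_id_right finite_TB,
      auto simp: comp_op_def id_op_def chord_op_outside intro!: sum.neutral)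
qed

lemma chord_op_casimir:
  "i \<in> {1..N} \<Longrightarrow> j \<in> {1..N} \<Longrightarrow> i \<noteq> j \<Longrightarrow> chord_op n N e \<rho> i j = casimir i j"
  by (rule chord_op_eq_casimir[OF orthonormal]) (use basis_site action_site in auto)

text \<open>Chord operators are Hermitian and the adjoint reverses products. Horizontality
  guarantees that each chord joins two distinct sites in range.\<close>

lemma diagram_op_rev:
  assumes "d \<in> horizontal_diagrams N"
  shows "D (rev_diagram d) = adjoint_op (D d)"
proof -
  have "D (Diagram (rev cs)) = adjoint_op (D (Diagram cs))"
    if "\<forall>(i, j) \<in> set cs. 1 \<le> i \<and> i < j \<and> j \<le> N" for cs
    using that
  proof (induction cs)
    case Nil
    then show ?case by (simp add: diagram_op_Nil adjoint_op_id)
  next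
    case (Cons c cs)
    obtain i j where c: "c = (i, j)" by force
    have "D (Diagram (rev (c # cs))) = comp_op TB (D (Diagram (rev cs))) (chord_op n N e \<rho> i j)"
      using diagram_op_plus[of "Diagram (rev cs)" "Diagram [c]"]
      by (simp add: plus_diagram_def c diagram_op_single)
    also have "\<dots> = adjoint_op (D (Diagram (c # cs)))"
      using Cons by (simp add: c diagram_op_Cons adjoint_op_comp chord_op_casimir adjoint_casimir)
    finally show ?case .
  qed
  then show ?thesis using assms by (cases d) (simp add: rev_diagram_def horizontal_diagrams_def)
qed

section \<open>Linear extension and descent to the quotient\<close>

text \<open>Cancellation can shrink the support of a sum; a common larger index set makes the terms
  comparable.\<close>

lemma free_weight_hom_superset:
  assumes "finite K" "Poly_Mapping.keys x \<subseteq> K"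
  shows "W x s t = (\<Sum>d\<in>K. Poly_Mapping.lookup x d * D d s t)"
  unfolding free_weight_hom_def using assms by (intro sum.mono_neutral_left) (auto simp: in_keys_iff)

lemma free_weight_hom_add: "W (x + y) = W x + W y"
proof (intro ext)
  fix s t
  let ?K = "Poly_Mapping.keys x \<union> Poly_Mapping.keys y"
  have "Poly_Mapping.keys (x + y) \<subseteq> ?K" by (rule Poly_Mapping.keys_add)
  then show "W (x + y) s t = (W x + W y) s t"
    by (simp add: free_weight_hom_superset[of ?K] lookup_add distrib_right sum.distrib)
qed

lemma free_weight_hom_zero: "W 0 = 0"
  by (simp add: free_weight_hom_def fun_eq_iff)

lemma free_weight_hom_uminus: "W (- x) = - W x"
  using free_weight_hom_add[of x "- x"] by (simp add: free_weight_hom_zero eq_neg_iff_add_eq_0 add.commute)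

lemma free_weight_hom_single: "W (Poly_Mapping.single d c) s t = c * D d s t"
  by (simp add: free_weight_hom_def)

lemma free_weight_hom_mult: "W (x * y) = comp_op TB (W x) (W y)"
proof (induction x rule: poly_mapping_single_induct)
  case (single d c)
  show ?case
  proof (induction y rule: poly_mapping_single_induct)
    case (single d' c')
    show ?case
      by (intro ext) (simp add: mult_single free_weight_hom_single diagram_op_plus comp_op_def
          sum_distrib_left mult_ac)
  qed (simp_all add: free_weight_hom_add free_weight_hom_zero comp_op_bilinear distrib_left
      del: plus_fun_apply zero_fun_apply)
qed (simp_all add: free_weight_hom_add free_weight_hom_zero comp_op_bilinear distrib_right
      del: plus_fun_apply zero_fun_apply)

lemma free_weight_hom_smult: "W (diagram_smult c x) s t = c * W x s t"
proof (induction x rule: poly_mapping_single_induct)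
  case (single d c')
  then show ?case by (simp add: diagram_smult_eq_mult mult_single free_weight_hom_single)
qed (simp_all add: diagram_smult_eq_mult free_weight_hom_add free_weight_hom_zero distrib_left)

lemma free_weight_hom_star:
  assumes "x \<in> carrier (diagram_ring N)"
  shows "W (diagram_star x) = adjoint_op (W x)"
proof -
  have sum: "W (\<Sum>d\<in>K. f d) = (\<Sum>d\<in>K. W (f d))" for f :: "diagram \<Rightarrow> _" and K
    by (induction K rule: infinite_finite_induct)
      (simp_all add: free_weight_hom_add free_weight_hom_zero del: plus_fun_apply zero_fun_apply)
  show ?thesis
    unfolding diagram_star_def sum
    using assms by (intro ext) (auto simp: sum_operator_apply free_weight_hom_single adjoint_op_def
        free_weight_hom_def diagram_op_rev intro!: sum.cong)
qed

lemma free_weight_hom_chord: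
  assumes "i \<in> {1..N}" "j \<in> {1..N}" "i \<noteq> j"
  shows "W (chord i j) = casimir i j"
proof (intro ext)
  fix s t
  \<comment> \<open>\<open>chord\<close> sorts its endpoints, and the symmetry of the Casimir
    operator absorbs this.\<close>
  have "casimir (min i j) (max i j) = casimir i j"
    using casimir_commute[OF assms(3)] by (simp add: min_def max_def)
  moreover have "chord_op n N e \<rho> (min i j) (max i j) = casimir (min i j) (max i j)"
    using assms by (intro chord_op_casimir) (auto simp: min_def max_def)
  ultimately show "W (chord i j) s t = casimir i j s t"
    by (simp only: chord_def free_weight_hom_single diagram_op_single mult_1)
qed

text \<open>The kernel of \<open>W\<close> is an ideal, and the 2T and 4T relations are mapped to
  the brackets shown to vanish in \<open>casimir_2T\<close> and \<open>casimir_4T\<close>.\<close>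

lemma free_weight_hom_braid_ideal:
  assumes "h \<in> braid_ideal N"
  shows "W h = 0"
proof -
  let ?J = "{x \<in> carrier (diagram_ring N). W x = 0}"
  have diff: "W (x - y) = W x - W y" for x y
    using free_weight_hom_add[of x "- y"] by (simp add: free_weight_hom_uminus)
  have "ideal ?J (diagram_ring N)"
    by (intro ideal_diagram_ringI)
      (auto simp: free_weight_hom_add free_weight_hom_zero free_weight_hom_mult comp_op_bilinear
        intro: diagram_carrier_closed simp del: diagram_ring_simps plus_fun_apply zero_fun_apply)
  have rel_2T: "W (chord i j * chord k l - chord k l * chord i j) = 0"
    if "{i, j, k, l} \<subseteq> {1..N}" "distinct [i, j, k, l]" for i j k l
  proof -
    have "W (chord i j * chord k l - chord k l * chord i j) = bracket_op TB (casimir i j) (casimir k l)"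
      using that by (simp add: diff free_weight_hom_mult free_weight_hom_chord bracket_op_def)
    then show ?thesis using casimir_2T[OF that(2)] by simp
  qed
  have rel_4T: "W (chord i j * chord i k + chord i j * chord j k
      - chord i k * chord i j - chord j k * chord i j) = 0"
    if "{i, j, k} \<subseteq> {1..N}" "distinct [i, j, k]" for i j k
  proof -
    have "W (chord i j * chord i k + chord i j * chord j k - chord i k * chord i j - chord j k * chord i j) =
      bracket_op TB (casimir i j) (casimir i k + casimir j k)"
      using that by (simp add: diff free_weight_hom_add free_weight_hom_mult free_weight_hom_chord
          bracket_op_def comp_op_bilinear diff_diff_eq del: plus_fun_apply)
    then show ?thesis using casimir_4T[OF that] by simp
  qed
  have "W x = 0" if "x \<in> relations_2T N \<union> relations_4T N" for x
    using that unfolding relations_2T_def relations_4T_def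
    by (elim UnE CollectE exE conjE) (simp_all only: rel_2T rel_4T)
  then have "relations_2T N \<union> relations_4T N \<subseteq> ?J" using relations_closed by blast
  with \<open>ideal ?J _\<close> have "braid_ideal N \<subseteq> ?J" by (rule braid_ideal_minimal)
  then show ?thesis using assms by blast
qed

lemma weight_hom_coset: "weight_hom n N e \<rho> (braid_coset N x) = W x"
proof -
  have "W y = W x" if "y \<in> braid_coset N x" for y
    using that by (auto simp: braid_coset_eq free_weight_hom_add free_weight_hom_braid_ideal)
  moreover have "x \<in> braid_coset N x" using zero_in_braid_ideal by (force simp: braid_coset_eq)
  ultimately have "W ` braid_coset N x = {W x}" by blast
  then show ?thesis by (simp add: weight_hom_def)
qed

lemma weight_system_coset: "weight_system n N e \<rho> (braid_coset N x) = (\<Sum>s\<in>TB. W x s s)"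
  by (simp add: weight_system_def weight_hom_coset tensor_basis_eq trace_op_def)

text \<open>The value at the unit is the dimension of the tensor product, which is positive because
  no site basis is empty.\<close>

lemma quantum_state_weight_system:
  assumes "\<And>l. l \<in> {1..N} \<Longrightarrow> B l \<noteq> {}"
  shows "quantum_state (chord_algebra N) (weight_system n N e \<rho>)"
proof (intro quantum_state.intro quantum_state_axioms.intro)
  show "complex_star_algebra (chord_algebra N)" by (rule complex_star_algebra_chord_algebra)
next
  fix x y c d assume "x \<in> carrier (chord_algebra N)" "y \<in> carrier (chord_algebra N)"
  then obtain u v where "u \<in> carrier (diagram_ring N)" "x = braid_coset N u"
    and "v \<in> carrier (diagram_ring N)" "y = braid_coset N v"
    by (auto simp: chord_algebra_simps)
  then show "weight_system n N e \<rho> (c \<odot>\<^bsub>chord_algebra N\<^esub> x \<oplus>\<^bsub>chord_algebra N\<^esub> d \<odot>\<^bsub>chord_algebra N\<^esub> y) =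
    c * weight_system n N e \<rho> x + d * weight_system n N e \<rho> y"
    by (simp add: chord_algebra_simps diagram_smult_closed weight_system_coset free_weight_hom_add
        free_weight_hom_smult sum.distrib sum_distrib_left del: diagram_ring_simps)
next
  fix x assume "x \<in> carrier (chord_algebra N)"
  then obtain u where u: "u \<in> carrier (diagram_ring N)" "x = braid_coset N u"
    by (auto simp: chord_algebra_simps)
  \<comment> \<open>The star becomes the adjoint, so the trace is the sum of the diagonal entries of
    \<open>W u\<close> times its adjoint.\<close>
  have "weight_system n N e \<rho> (x \<otimes>\<^bsub>chord_algebra N\<^esub> star (chord_algebra N) x) =
    (\<Sum>s\<in>TB. \<Sum>t\<in>TB. W u s t * cnj (W u s t))"
    using u by (simp add: chord_algebra_simps diagram_star_closed weight_system_coset free_weight_hom_mult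
        free_weight_hom_star comp_op_def adjoint_op_def del: diagram_ring_simps)
  also have "\<dots> = of_real (\<Sum>s\<in>TB. \<Sum>t\<in>TB. (cmod (W u s t))\<^sup>2)"
    by (simp only: of_real_sum complex_norm_square)
  also have "\<dots> \<in> \<real>\<^sub>\<ge>\<^sub>0" by (simp only: nonneg_Reals_of_real_iff sum_nonneg zero_le_power2)
  finally show "weight_system n N e \<rho> (x \<otimes>\<^bsub>chord_algebra N\<^esub> star (chord_algebra N) x) \<in> \<real>\<^sub>\<ge>\<^sub>0" .
next
  have "W 1 = id_op TB"
    using diagram_op_Nil
    by (intro ext) (simp add: free_weight_hom_single zero_diagram_def flip: single_one)
  then have "weight_system n N e \<rho> \<one>\<^bsub>chord_algebra N\<^esub> = of_nat (card TB)"
    by (simp add: chord_algebra_simps weight_system_coset id_op_def)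
  moreover have "TB \<noteq> {}" using assms by (auto simp: tensor_basis_def PiE_eq_empty_iff)
  ultimately show "weight_system n N e \<rho> \<one>\<^bsub>chord_algebra N\<^esub> \<in> \<real> \<and> Re (weight_system n N e \<rho> \<one>\<^bsub>chord_algebra N\<^esub>) > 0"
    using finite_TB by (simp add: card_gt_0_iff)
qed

end

section \<open>Specialization to exterior powers\<close>

theorem corollary3:
  fixes n N :: nat
    and e :: "nat \<Rightarrow> complex mat"
    and k :: "nat \<Rightarrow> nat"
    and \<rho> :: "nat \<Rightarrow> nat set representation"
  assumes "n \<ge> 1" and "N \<ge> 1"
    and "orthonormal_basis n e"
    and "\<And>i. i \<in> {1..N} \<Longrightarrow> 1 \<le> k i \<and> k i \<le> n"
    and "\<And>i. i \<in> {1..N} \<Longrightarrow> \<rho> i = exterior_power n (k i)"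
  shows "quantum_state (chord_algebra N) (weight_system n N e \<rho>)"
proof -
  \<comment> \<open>The same matrix units on Fock space serve every site; the degree
    \<open>k l\<close> enters through the basis alone.\<close>
  interpret gl_weight_system n N "\<lambda>l. ext_basis n (k l)" "\<lambda>l. ext_unit n" e \<rho>
  proof
    fix l a b c d S T
    assume "a < n" "b < n" "c < n" "d < n" "T \<in> ext_basis n (k l)"
    then show "bracket_op (ext_basis n (k l)) (ext_unit n a b) (ext_unit n c d) S T =
      (if b = c then ext_unit n a d S T else 0) - (if a = d then ext_unit n c b S T else 0)"
      using fun_cong[OF fun_cong[OF ext_unit_commutator[of a n b c d]], of S T]
      by (auto simp: bracket_op_def comp_op_ext_unit_ext_basis)
  next
    fix l S T and A :: "complex mat"
    assume "l \<in> {1..N}" "A \<in> carrier_mat n n" "S \<in> ext_basis n (k l)" "T \<in> ext_basis n (k l)"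
    then show "action (\<rho> l) A S T = (\<Sum>a<n. \<Sum>b<n. A $$ (a, b) * ext_unit n a b S T)"
      using ext_action_eq_sum_units by (simp add: assms(5) exterior_power_def)
  next
    fix a b
    show "adjoint_op (ext_unit n a b) = ext_unit n b a"
      unfolding adjoint_op_def by (intro ext) (rule ext_unit_adjoint[symmetric])
  qed (use assms(3,5) in \<open>auto simp: exterior_power_def finite_ext_basis\<close>)
  \<comment> \<open>The wedge of the first \<open>k l\<close> unit vectors is a basis vector because
    \<open>k l \<le> n\<close>.\<close>
  have "{..<k l} \<in> ext_basis n (k l)" if "l \<in> {1..N}" for l
    using assms(4)[OF that] by (auto simp: ext_basis_iff)
  then show ?thesis by (intro quantum_state_weight_system) blast
qed

end
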